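(* For each $N\ge1$ there is a constant $C_N>0$, depending only on $N$, such that the following holds. Let $(X,\varphi)$ be a bounded $N$-dimensional Lattice EDS, let $\beta=\sup_{u\in X} b(\|e_u\|_\infty)$ (so that $|f|^2\le\beta d$), let $u\in X$, $u(t)=\varphi(u,t)$, $e_0=\|e_{u(0)}\|_\infty$, and for an integer $R\ge1$ and $T>0$ let $$D(R,T)=\int_0^T\sum_{\alpha\in C^*(R)}d_{u(t)}(\alpha)\,dt .$$ Then for any integer $R\ge1$: (i) if $N=1$, then $\limsup_{T\to\infty}\frac{1}{\sqrt T}D(R,T)\le C_1\sqrt{\beta e_0}$; (ii) if $N=2$, then $\limsup_{T\to\infty}\frac{\log T}{T}D(R,T)\le C_2\,\beta$; (iii) if $N\ge3$, then $\limsup_{T\to\infty}\frac{1}{T}D(R,T)\le C_N\,\beta R^{N-2}$.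
   Context: Notation: $\varepsilon_1,\dots,\varepsilon_N$ is the standard basis of $\mathbb{Z}^N$; for $v:\mathbb{Z}^N\to\mathbb{R}^N$, $\operatorname{div} v(\alpha)=\sum_{j=1}^N \big(v_j(\alpha)-v_j(\alpha-\varepsilon_j)\big)$; $l_\infty(\mathbb{Z}^N)$ is the space of bounded functions $\mathbb{Z}^N\to\mathbb{R}$ with sup-norm $\|\cdot\|_\infty$; $\mathbb{R}^+=[0,\infty)$; $C^*(R)=\{\alpha\in\mathbb{Z}^N: -R+1\le \alpha_j\le R,\ j=1,\dots,N\}$. Definition (Lattice EDS). Let $X$ be a metrizable space and $\varphi$ a continuous semiflow on $X$; write $u(t)=\varphi(u,t)$, $t\ge 0$. A point $u\in X$ is stationary (an equilibrium) if $\varphi(u,t)=u$ for all $t\ge 0$. $(X,\varphi)$ is an $N$-dimensional extended dissipative system on a lattice (Lattice EDS) if there are functions $e,d,f_1,\dots,f_N:X\to l_\infty(\mathbb{Z}^N)$ (energy, dissipation, flux $f=(f_1,\dots,f_N)$), written $u\mapsto e_u,d_u,f_u$, fixed once and for all, such that: (A1) $e_u(\alpha)\ge 0$, $d_u(\alpha)\geq 0$ for all $u\in X$, $\alpha\in\mathbb{Z}^N$. (A2) For each $\alpha$, the maps $u\mapsto e_u(\alpha),d_u(\alpha),(f_1)_u(\alpha),\dots,(f_N)_u(\alpha)$ are continuous $X\to\mathbb{R}$; and for each $u\in X$ the maps $t\mapsto\|e_{u(t)}\|_\infty,\|d_{u(t)}\|_\infty,\|f_{u(t)}\|_\infty$ are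 continuous $\mathbb{R}^+\to\mathbb{R}^+$. (A3) If $d_u\equiv 0$ then $u$ is stationary. (A4) Along each semiorbit $u(t)$ and at each $\alpha$, $\partial_t e_{u(t)}(\alpha)=-d_{u(t)}(\alpha)+\operatorname{div} f_{u(t)}(\alpha)$, with $\partial_t$ in the sense of distributions. (A5) There is a non-decreasing $b:\mathbb{R}^+\to\mathbb{R}^+$ such that $|f_u(\alpha)|^2\le b(\|e_u\|_\infty)\, d_u(\alpha)$ for all $u\in X$, $\alpha\in\mathbb{Z}^N$. The Lattice EDS is bounded if $\sup_{u\in X}\|e_u\|_\infty<\infty$. *)

theory Defs
  imports "HOL-Analysis.Analysis"
begin

text \<open>
  The lattice of dimension N = CARD('n) is the type int^'n; its standard basis vectors are
  axis j 1. It carries the discrete topology, so (int^'n) =>C E is exactly the space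
  of bounded functions on the lattice, and its norm is the sup-norm.
\<close>

type_synonym ('n, 'e) linf = "(int ^ 'n) \<Rightarrow>\<^sub>C 'e"

lemma open_lattice:
  fixes S :: "(int ^ 'n::finite) set"
  shows "open S"
  unfolding open_vec_def
proof (intro ballI exI conjI allI impI)
  fix x y :: "int ^ 'n" and i
  show "open {x $ i}" "x $ i \<in> {x $ i}"
    by (auto intro: open_discrete)
  assume "x \<in> S" "\<forall>i. y $ i \<in> {x $ i}"
  then show "y \<in> S"
    by (simp add: vec_eq_iff[symmetric])
qed

lemma bcontfun_lattice: "bcontfun = {v :: int ^ 'n::finite \<Rightarrow> 'e::metric_space. bounded (range v)}"
  by (auto simp: bcontfun_def continuous_on_open_vimage open_lattice)

lemma norm_linf: "norm v = (SUP \<alpha>. norm (apply_bcontfun v \<alpha>))"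
  for v :: "('n::finite, 'e::real_normed_vector) linf"
  by (simp add: norm_bcontfun_def dist_bcontfun.rep_eq)

definition lattice_div :: "(int ^ 'n::finite \<Rightarrow> real ^ 'n) \<Rightarrow> int ^ 'n \<Rightarrow> real" where
  "lattice_div v \<alpha> = (\<Sum>j\<in>UNIV. v \<alpha> $ j - v (\<alpha> - axis j 1) $ j)"

definition lattice_cube :: "nat \<Rightarrow> (int ^ 'n::finite) set" where
  "lattice_cube R = {\<alpha>. \<forall>j. - int R + 1 \<le> \<alpha> $ j \<and> \<alpha> $ j \<le> int R}"

lemma finite_lattice_cube: "finite (lattice_cube R :: (int ^ 'n::finite) set)"
proof -
  have "lattice_cube R \<subseteq> vec_lambda ` (UNIV \<rightarrow>\<^sub>E {- int R + 1..int R})"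
    by (auto simp: lattice_cube_def image_iff PiE_UNIV_domain vec_eq_iff
        intro!: bexI[of _ "\<lambda>j. vec_nth _ j"])
  then show ?thesis
    by (rule finite_subset) (intro finite_imageI finite_PiE; simp)
qed

text \<open>
  Distributional derivatives on the half-line: test functions are smooth with compact support
  contained in the open interval from 0 to infinity.
\<close>

definition test_function :: "(real \<Rightarrow> real) \<Rightarrow> bool" where
  "test_function \<psi> \<longleftrightarrow>
     (\<forall>k. (deriv ^^ k) \<psi> differentiable_on UNIV) \<and>
     compact (closure {t. \<psi> t \<noteq> 0}) \<and> closure {t. \<psi> t \<noteq> 0} \<subseteq> {0<..}"

definition has_distributional_derivative :: "(real \<Rightarrow> real) \<Rightarrow> (real \<Rightarrow> real) \<Rightarrow> bool" where
  "has_distributional_derivative g h \<longleftrightarrow>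
     (\<forall>\<psi>. test_function \<psi> \<longrightarrow>
        integral {0<..} (\<lambda>t. g t * deriv \<psi> t) = - integral {0<..} (\<lambda>t. h t * \<psi> t))"

text \<open>
  The state space is the carrier of the topology X; only times t >= 0 matter.
\<close>

locale semiflow =
  fixes X :: "'x topology" and \<phi> :: "'x \<Rightarrow> real \<Rightarrow> 'x"
  assumes metrizable: "metrizable_space X"
    and flow_continuous:
      "continuous_map (prod_topology X (top_of_set {0..})) X (\<lambda>(u, t). \<phi> u t)"
    and flow_zero: "u \<in> topspace X \<Longrightarrow> \<phi> u 0 = u"
    and flow_add: "\<lbrakk>u \<in> topspace X; 0 \<le> s; 0 \<le> t\<rbrakk> \<Longrightarrow> \<phi> u (s + t) = \<phi> (\<phi> u s) t"
begin

definition stationary :: "'x \<Rightarrow> bool" where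
  "stationary u \<longleftrightarrow> (\<forall>t\<ge>0. \<phi> u t = u)"

end

text \<open>
  The norm of the flux is the supremum over the lattice of the Euclidean length of the flux
  vector, the same length that enters the bound of the flux by the dissipation.
\<close>

locale lattice_eds = semiflow X \<phi> for X :: "'x topology" and \<phi> :: "'x \<Rightarrow> real \<Rightarrow> 'x" +
  fixes e d :: "'x \<Rightarrow> ('n::finite, real) linf"
    and f :: "'x \<Rightarrow> ('n, real ^ 'n) linf"
    and b :: "real \<Rightarrow> real"
  assumes energy_nonneg: "u \<in> topspace X \<Longrightarrow> 0 \<le> e u \<alpha>"
    and dissipation_nonneg: "u \<in> topspace X \<Longrightarrow> 0 \<le> d u \<alpha>"
    and energy_continuous: "continuous_map X euclideanreal (\<lambda>u. e u \<alpha>)"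
    and dissipation_continuous: "continuous_map X euclideanreal (\<lambda>u. d u \<alpha>)"
    and flux_continuous: "continuous_map X euclideanreal (\<lambda>u. f u \<alpha> $ j)"
    and norm_energy_continuous:
      "u \<in> topspace X \<Longrightarrow> continuous_on {0..} (\<lambda>t. norm (e (\<phi> u t)))"
    and norm_dissipation_continuous:
      "u \<in> topspace X \<Longrightarrow> continuous_on {0..} (\<lambda>t. norm (d (\<phi> u t)))"
    and norm_flux_continuous:
      "u \<in> topspace X \<Longrightarrow> continuous_on {0..} (\<lambda>t. norm (f (\<phi> u t)))"
    and no_dissipation_stationary:
      "\<lbrakk>u \<in> topspace X; \<And>\<alpha>. d u \<alpha> = 0\<rbrakk> \<Longrightarrow> stationary u"
    and energy_balance:
      "u \<in> topspace X \<Longrightarrow>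
         has_distributional_derivative (\<lambda>t. e (\<phi> u t) \<alpha>)
           (\<lambda>t. - d (\<phi> u t) \<alpha> + lattice_div (f (\<phi> u t)) \<alpha>)"
    and b_nonneg: "0 \<le> r \<Longrightarrow> 0 \<le> b r"
    and b_mono: "mono_on {0..} b"
    and flux_bound: "u \<in> topspace X \<Longrightarrow> (norm (f u \<alpha>))\<^sup>2 \<le> b (norm (e u)) * d u \<alpha>"

definition bounded_lattice_eds ::
  "'x topology \<Rightarrow> ('x \<Rightarrow> real \<Rightarrow> 'x) \<Rightarrow> ('x \<Rightarrow> ('n::finite, real) linf) \<Rightarrow>
   ('x \<Rightarrow> ('n, real) linf) \<Rightarrow> ('x \<Rightarrow> ('n, real ^ 'n) linf) \<Rightarrow> (real \<Rightarrow> real) \<Rightarrow> bool" where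
  "bounded_lattice_eds X \<phi> e d f b \<longleftrightarrow>
     lattice_eds X \<phi> e d f b \<and> bdd_above ((\<lambda>u. norm (e u)) ` topspace X)"

definition total_dissipation ::
  "('x \<Rightarrow> real \<Rightarrow> 'x) \<Rightarrow> ('x \<Rightarrow> ('n::finite, real) linf) \<Rightarrow> 'x \<Rightarrow> nat \<Rightarrow> real \<Rightarrow> real" where
  "total_dissipation \<phi> d u R T = integral {0..T} (\<lambda>t. \<Sum>\<alpha>\<in>lattice_cube R. d (\<phi> u t) \<alpha>)"

text \<open>
  The constant has to be the same for all state spaces, of whatever type, but a quantifier over
  types cannot appear under an existential quantifier. It is therefore given by
  a closed term in which the type of the state space does not occur: a choice among the constants
  that are valid for all bounded systems whose state space is a topological space on a subset of
  the reals. Nothing is lost by testing on such spaces: the bounds only concern a single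
  semiorbit u(t), which can be parametrised by time (as a system on an interval starting at 0,
  with semiflow (s,t) |-> min (s + t) s0, where s0 is the first time at which the dissipation
  vanishes identically, or without the minimum if there is no such time).
  Whether a number is valid only depends on CARD('n), hence so does the constant.
\<close>

definition valid_eds_constant :: "'x itself \<Rightarrow> 'n::finite itself \<Rightarrow> real \<Rightarrow> bool" where
  "valid_eds_constant _ _ C \<longleftrightarrow>
     (\<forall>(X :: 'x topology) \<phi> (e :: 'x \<Rightarrow> ('n, real) linf) d f b u (R::nat).
        bounded_lattice_eds X \<phi> e d f b \<and> u \<in> topspace X \<and> R \<ge> 1 \<longrightarrow>
        (let \<beta> = (SUP w\<in>topspace X. b (norm (e w)));
             e0 = norm (e (\<phi> u 0));
             D = total_dissipation \<phi> d u
         in (CARD('n) = 1 \<longrightarrow>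
               Limsup at_top (\<lambda>T. ereal (1 / sqrt T * D R T)) \<le> ereal (C * sqrt (\<beta> * e0))) \<and>
            (CARD('n) = 2 \<longrightarrow>
               Limsup at_top (\<lambda>T. ereal (ln T / T * D R T)) \<le> ereal (C * \<beta>)) \<and>
            (CARD('n) \<ge> 3 \<longrightarrow>
               Limsup at_top (\<lambda>T. ereal (1 / T * D R T))
                 \<le> ereal (C * \<beta> * real R ^ (CARD('n) - 2)))))"

definition eds_constant :: "'n::finite itself \<Rightarrow> real" where
  "eds_constant N = (SOME C. C > 0 \<and> valid_eds_constant TYPE(real) N C)"

end

theory Submission
  imports Defs "HOL-Computational_Algebra.Polynomial"
begin

text \<open>
  For a positive summable weight w on the lattice, summation by parts in the energy balance, the
  bound of the flux by the dissipation and Young's inequality give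
  \<integral>\<Sum> w d \<le> 2 \<Sum> w e + N \<beta> T \<Sum> |\<nabla>w|^2 / w. What remains is a choice of w, comparable to 1 on the
  cube: with w = exp (- |\<alpha>| / L) take L = \<lambda> \<surd>T and optimise \<lambda> in dimension 1, and L = R in
  dimension at least 3; in dimension 2 take w = \<eta>^2 where \<eta> is the average of exp (- |\<alpha>| / 2^k)
  over k < m with m \<approx> ln T / 3, which behaves like the logarithmic potential and has
  \<Sum> |\<nabla>\<eta>|^2 = O(1/m). Finally, a constant that is valid for systems on the reals is valid for all
  systems, because a semiorbit can be parametrised by time.
\<close>

subsection \<open>The fundamental theorem of calculus for distributional derivatives\<close>

text \<open>With an exponential weight of width L \<ge> R the weighted inequality reads, up to
  constants depending on N, D(R,T) \<le> e0 L^N + \<beta> T L^(N-2). For N = 1 the two terms balance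
  at L of order sqrt T. For N \<ge> 3 the second term favours small L, and L = R is the smallest
  width, up to a factor, that keeps the weight comparable to 1 on the cube. For N = 2 the second
  term is \<beta> T whatever L is; only a weight that spreads its gradient evenly over many scales
  gains the factor 1 / log T, which reflects the vanishing capacity of a point in the plane.
  Dividing by w calls for weights that are positive everywhere and comparable at neighbouring
  points. Such weights never vanish, so the balance is summed over finite cubes first, with a
  boundary error that disappears because w is summable. The energy balance holds only in the sense
  of distributions, tested on functions vanishing near time 0, whereas the argument compares the
  energies at times 0 and T. Continuity along the semiorbit closes this gap.\<close>

text \<open>
  A family of functions closed under differentiation, so that all its members are smooth; it
  contains bump functions as products of a flat function and a reflected one.
\<close>

inductive flat_span :: "(real \<Rightarrow> real) \<Rightarrow> bool" where
  flat: "flat_span (\<lambda>x. if x \<le> 0 then 0 else poly p (1 / x) * exp (- (1 / x)))"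
| add: "flat_span g \<Longrightarrow> flat_span h \<Longrightarrow> flat_span (\<lambda>x. g x + h x)"
| mult: "flat_span g \<Longrightarrow> flat_span h \<Longrightarrow> flat_span (\<lambda>x. g x * h x)"
| affine: "flat_span g \<Longrightarrow> flat_span (\<lambda>x. a * g (c * x + s))"

lemma poly_over_exp_tendsto_0: "((\<lambda>x. poly p x * exp (- x)) \<longlongrightarrow> 0) at_top" for p :: "real poly"
proof (induction p)
  case 0
  then show ?case by simp
next
  case (pCons a p)
  have "((\<lambda>x. a * (x ^ 0 / exp x) + (\<Sum>i\<le>degree p. coeff p i * (x ^ Suc i / exp x))) \<longlongrightarrow>
          a * 0 + (\<Sum>i\<le>degree p. coeff p i * 0)) at_top"
    by (intro tendsto_intros tendsto_power_div_exp_0)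
  moreover have "(\<lambda>x. a * (x ^ 0 / exp x) + (\<Sum>i\<le>degree p. coeff p i * (x ^ Suc i / exp x))) =
      (\<lambda>x. poly (pCons a p) x * exp (- x))"
    by (auto simp: fun_eq_iff poly_altdef[of p] exp_minus field_simps sum_distrib_left
        sum_distrib_right simp flip: sum_divide_distrib intro!: sum.cong)
  ultimately show ?case
    by simp
qed

text \<open>For x > 0 the chain rule yields (p - p')(1/x) * (1/x)^2 * exp (-1/x), and
  \<open>[:0, 0, 1:]\<close> is the factor (1/x)^2; the derivative thus has the same shape as the
  function.\<close>

lemma flat_has_derivative:
  fixes p :: "real poly"
  shows "((\<lambda>x. if x \<le> 0 then 0 else poly p (1 / x) * exp (- (1 / x))) has_real_derivative
    (if x \<le> 0 then 0 else poly ([:0, 0, 1:] * (p - pderiv p)) (1 / x) * exp (- (1 / x)))) (at x)"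
    (is "(?F has_real_derivative _) _")
proof -
  consider "x < 0" | "x = 0" | "x > 0" by linarith
  then show ?thesis
  proof cases
    case 1
    have "((\<lambda>x. 0) has_real_derivative 0) (at x)" by simp
    then have "(?F has_real_derivative 0) (at x)"
      by (rule has_field_derivative_transform_within_open[of _ _ _ "{..<0}"]) (use 1 in auto)
    then show ?thesis using 1 by simp
  next
    case 2
    \<comment> \<open>Dividing by h multiplies the polynomial in 1/h by its variable, hence
      \<open>pCons 0 p\<close>.\<close>
    have "((\<lambda>h. poly (pCons 0 p) (inverse h) * exp (- inverse h)) \<longlongrightarrow> 0) (at_right 0)"
      using poly_over_exp_tendsto_0[of "pCons 0 p"] by (simp only: filterlim_at_right_to_top inverse_inverse_eq)
    then have "((\<lambda>h. ?F h / h) \<longlongrightarrow> 0) (at_right 0)"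
      by (rule Lim_transform_eventually)
        (auto simp: eventually_at_right_field field_simps intro!: exI[of _ 1])
    moreover have "((\<lambda>h. ?F h / h) \<longlongrightarrow> 0) (at_left 0)"
      by (rule tendsto_eventually) (auto simp: eventually_at_left_field intro!: exI[of _ "-1"])
    ultimately have "((\<lambda>h. ?F h / h) \<longlongrightarrow> 0) (at 0)"
      by (simp add: filterlim_split_at)
    then show ?thesis
      using 2 by (simp add: DERIV_def cong: if_cong)
  next
    case 3
    have "((\<lambda>x. poly p (1 / x) * exp (- (1 / x))) has_real_derivative
        poly ([:0, 0, 1:] * (p - pderiv p)) (1 / x) * exp (- (1 / x))) (at x)"
      using 3
      by (auto intro!: derivative_eq_intros poly_DERIV[THEN DERIV_chain2] simp: power2_eq_square field_simps)
    then have "(?F has_real_derivative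
        poly ([:0, 0, 1:] * (p - pderiv p)) (1 / x) * exp (- (1 / x))) (at x)"
      by (rule has_field_derivative_transform_within_open[of _ _ _ "{0<..}"]) (use 3 in auto)
    then show ?thesis using 3 by simp
  qed
qed

lemma flat_span_has_derivative:
  assumes "flat_span g"
  shows "\<exists>g'. flat_span g' \<and> (\<forall>x. (g has_real_derivative g' x) (at x))"
  using assms
proof induction
  case (flat p)
  show ?case
    using flat_has_derivative[of p] flat_span.flat[of "[:0, 0, 1:] * (p - pderiv p)"] by blast
next
  case (add g h)
  then obtain g' h' where "flat_span g'" "flat_span h'"
    and "\<And>x. (g has_real_derivative g' x) (at x)" "\<And>x. (h has_real_derivative h' x) (at x)" by blast
  then show ?case
    by (intro exI[of _ "\<lambda>x. g' x + h' x"]) (auto intro: flat_span.intros derivative_intros)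
next
  case (mult g h)
  then obtain g' h' where "flat_span g'" "flat_span h'"
    and "\<And>x. (g has_real_derivative g' x) (at x)" "\<And>x. (h has_real_derivative h' x) (at x)" by blast
  then show ?case
    using mult.hyps
    by (intro exI[of _ "\<lambda>x. g' x * h x + h' x * g x"]) (auto intro!: flat_span.add flat_span.mult DERIV_mult)
next
  case (affine g a c s)
  then obtain g' where g': "flat_span g'" and D: "\<And>x. (g has_real_derivative g' x) (at x)" by blast
  have "((\<lambda>x. a * g (c * x + s)) has_real_derivative a * c * g' (c * x + s)) (at x)" for x
    by (auto intro!: derivative_eq_intros D[THEN DERIV_chain2])
  then show ?case
    using flat_span.affine[OF g', of "a * c" c s] by blast
qed

lemma flat_span_deriv: "flat_span g \<Longrightarrow> flat_span (deriv g)"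
  by (metis (no_types, lifting) DERIV_imp_deriv ext flat_span_has_derivative)

lemma flat_span_differentiable: "flat_span g \<Longrightarrow> g differentiable_on UNIV"
  by (meson differentiable_at_imp_differentiable_on flat_span_has_derivative real_differentiable_def)

text \<open>The test functions built below are differences of primitives of bumps. They are not
  exhibited as members of the family, only their derivatives are, and that suffices for
  smoothness.\<close>

lemma smooth_if_deriv_flat_span:
  assumes "\<psi> differentiable_on UNIV" "flat_span (deriv \<psi>)"
  shows "(deriv ^^ k) \<psi> differentiable_on UNIV"
proof (cases k)
  case (Suc n)
  have "flat_span ((deriv ^^ n) (deriv \<psi>))"
    by (induction n) (simp_all add: assms flat_span_deriv)
  then show ?thesis
    using Suc by (simp add: flat_span_differentiable funpow_swap1)
qed (use assms in simp)

section \<open>Bump functions and their primitives\<close>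

lemma bump_exists:
  assumes "0 < (\<epsilon> :: real)"
  obtains \<rho> where "flat_span \<rho>" "\<And>x. 0 < x \<Longrightarrow> x < \<epsilon> \<Longrightarrow> \<rho> x > 0" "\<And>x. x \<le> 0 \<or> x \<ge> \<epsilon> \<Longrightarrow> \<rho> x = 0"
proof
  define F :: "real \<Rightarrow> real" where "F = (\<lambda>x. if x \<le> 0 then 0 else poly 1 (1 / x) * exp (- (1 / x)))"
  have "flat_span F" unfolding F_def by (rule flat_span.flat)
  \<comment> \<open>F x is positive for x > 0 only, and F (\<epsilon> - x) for x < \<epsilon> only.
    The reflected factor is spelled so as to match the rule \<open>affine\<close>.\<close>
  then show "flat_span (\<lambda>x. F x * (1 * F ((-1) * x + \<epsilon>)))"
    by (intro flat_span.intros)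
qed auto

lemma flat_span_continuous: "flat_span g \<Longrightarrow> continuous_on A g"
  by (meson DERIV_continuous_on DERIV_subset flat_span_has_derivative subset_UNIV)

text \<open>P is a smoothed step, constant on both sides of the bump; the difference of two
  translates of P therefore has compact support.\<close>

lemma bump_primitive:
  assumes \<rho>: "flat_span \<rho>" "\<And>x. x \<le> 0 \<or> x \<ge> \<epsilon> \<Longrightarrow> \<rho> x = 0" and "0 < \<epsilon>"
  obtains P where "\<And>x. (P has_real_derivative \<rho> x) (at x)" "\<And>x. x \<le> 0 \<Longrightarrow> P x = 0"
    "\<And>x. x \<ge> \<epsilon> \<Longrightarrow> P x = P \<epsilon>"
proof
  \<comment> \<open>The base point -1 lies strictly left of the support, so every x \<ge> 0 is
    interior to \<open>{-1..x+1}\<close> and the derivative there is two-sided.\<close>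
  define P where "P = (\<lambda>x. integral {-1..x} \<rho>)"
  show P0: "P x = 0" if "x \<le> 0" for x
    unfolding P_def using that \<rho>(2) by (subst integral_cong[of _ _ "\<lambda>_. 0"]) auto
  have int: "\<rho> integrable_on {x..y}" for x y
    by (intro integrable_continuous_interval flat_span_continuous \<rho>)
  show "P x = P \<epsilon>" if "x \<ge> \<epsilon>" for x
  proof -
    have "integral {-1..\<epsilon>} \<rho> + integral {\<epsilon>..x} \<rho> = integral {-1..x} \<rho>"
      using that \<open>0 < \<epsilon>\<close> by (intro Henstock_Kurzweil_Integration.integral_combine int) auto
    moreover have "integral {\<epsilon>..x} \<rho> = 0"
      using \<rho>(2) by (subst integral_cong[of _ _ "\<lambda>_. 0"]) auto
    ultimately show ?thesis by (simp add: P_def)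
  qed
  show "(P has_real_derivative \<rho> x) (at x)" for x
  proof (cases "x < 0")
    case True
    have "((\<lambda>x. 0) has_real_derivative 0) (at x)" by simp
    then have "(P has_real_derivative 0) (at x)"
      by (rule has_field_derivative_transform_within_open[of _ _ _ "{..<0}"]) (use True P0 in auto)
    then show ?thesis using True \<rho>(2) by simp
  next
    case False
    have "(P has_real_derivative \<rho> x) (at x within {-1..x+1})"
      unfolding P_def
      by (intro integral_has_real_derivative flat_span_continuous \<rho>) (use False in auto)
    moreover have "at x within {-1..x+1} = at x"
      using False by (intro at_within_interior) auto
    ultimately show ?thesis by simp
  qed
qed

lemma integral_pos_eq_integral_Icc:
  assumes "\<And>t. t \<le> 0 \<or> t > B \<Longrightarrow> F t = 0"
  shows "integral {0<..} F = integral {0..B::real} (F :: real \<Rightarrow> real)"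
proof -
  have "integral UNIV (\<lambda>x. if x \<in> {0<..} then F x else 0) = integral UNIV (\<lambda>x. if x \<in> {0..B} then F x else 0)"
    using assms by (intro arg_cong[where f = "integral UNIV"]) (auto simp: fun_eq_iff not_less)
  then show ?thesis
    by (simp only: integral_restrict_UNIV)
qed

lemma integral_shifted_bump:
  assumes k: "continuous_on {0..} k" and \<rho>: "flat_span \<rho>" "\<And>x. x \<le> 0 \<or> x \<ge> \<epsilon> \<Longrightarrow> \<rho> x = 0"
    and "0 < \<epsilon>" "0 < a" "a + \<epsilon> \<le> B"
  shows "integral {0..B} (\<lambda>t. k t * \<rho> (t - a)) = integral {0..\<epsilon>} (\<lambda>t. k (a + t) * \<rho> t)"
proof -
  have c: "continuous_on {0..} (\<lambda>t. k t * \<rho> (t - a))"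
    by (intro continuous_intros k continuous_on_compose2[OF flat_span_continuous[OF \<rho>(1), of UNIV]]) auto
  have "integral {0..B} (\<lambda>t. k t * \<rho> (t - a)) = integral {a..a+\<epsilon>} (\<lambda>t. k t * \<rho> (t - a))"
    by (subst (1 2) integral_restrict_UNIV[symmetric], rule arg_cong[where f = "integral UNIV"])
      (use assms(4-) in \<open>auto simp: fun_eq_iff \<rho>(2)\<close>)
  also have "\<dots> = integral {0..\<epsilon>} (\<lambda>t. k (a + t) * \<rho> t)"
    using integral_shift[OF continuous_on_subset[OF c], of 0 a \<epsilon>] \<open>0 < a\<close>
    by (simp add: o_def add.commute)
  finally show ?thesis .
qed

text \<open>The du Bois-Reymond lemma: k = g - H, with H the integral of h, has weak derivative 0
  and is therefore constant. Continuity makes this an equality at every time and not merely almost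
  everywhere.\<close>

lemma distributional_derivative_FTC:
  assumes g: "continuous_on {0..} g" and h: "continuous_on {0..} h"
    and gh: "has_distributional_derivative g h" and "0 \<le> T"
  shows "g T - g 0 = integral {0..T} h"
proof -
  define H where "H = (\<lambda>t. integral {0..t} h)"
  define k where "k = (\<lambda>t. g t - H t)"
  have hB: "continuous_on {0..B} h" for B
    by (rule continuous_on_subset[OF h]) auto
  have HD: "(H has_real_derivative h t) (at t within {0..B})" if "t \<in> {0..B}" for t B
    unfolding H_def using that by (intro integral_has_real_derivative hB)
  have Hc: "continuous_on {0..B} H" for B
    by (rule DERIV_continuous_on[of _ _ h]) (rule HD)
  have H: "continuous_on {0..} H"
    unfolding continuous_on_eq_continuous_within
  proof
    fix t :: real assume "t \<in> {0..}"
    then have "continuous (at t within {0..t+1}) H"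
      by (intro DERIV_continuous[OF HD]) auto
    moreover have "at t within {0..t+1} = at t within {0..}"
      by (rule at_within_nhd[of _ "{..<t+1}"]) auto
    ultimately show "continuous (at t within {0..}) H" by simp
  qed
  have k: "continuous_on {0..} k"
    unfolding k_def by (intro continuous_intros g H)
  have bump: "integral {0..\<epsilon>} (\<lambda>t. (k (a + t) - k (b + t)) * \<rho> t) = 0"
    if \<rho>: "flat_span \<rho>" "\<And>x. x \<le> 0 \<or> x \<ge> \<epsilon> \<Longrightarrow> \<rho> x = 0" and "0 < \<epsilon>" "0 < a" "a < b" for a b \<epsilon> \<rho>
  proof -
    obtain P where P: "\<And>x. (P has_real_derivative \<rho> x) (at x)" "\<And>x. x \<le> 0 \<Longrightarrow> P x = 0"
      "\<And>x. x \<ge> \<epsilon> \<Longrightarrow> P x = P \<epsilon>"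
      using bump_primitive[OF \<rho> \<open>0 < \<epsilon>\<close>] by blast
    \<comment> \<open>The steps at a and b have equal height and cancel beyond b + \<epsilon>, so
      \<psi> is supported in [a, b + \<epsilon>], away from time 0. Its derivative compares k near a
      with k near b.\<close>
    define \<psi> where "\<psi> = (\<lambda>t. P (t - a) - P (t - b))"
    define \<psi>' where "\<psi>' = (\<lambda>t. \<rho> (t - a) - \<rho> (t - b))"
    have \<psi>D: "(\<psi> has_real_derivative \<psi>' t) (at t)" for t
      unfolding \<psi>_def \<psi>'_def by (auto intro!: derivative_eq_intros P(1)[THEN DERIV_chain2])
    have d\<psi>: "deriv \<psi> = \<psi>'"
      using \<psi>D by (auto intro: DERIV_imp_deriv)
    define B where "B = b + \<epsilon>"
    have \<psi>0: "\<psi> t = 0" "\<psi>' t = 0" if "t \<le> a \<or> t \<ge> B" for t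
      using that \<open>a < b\<close> \<open>0 < \<epsilon>\<close> P(2)[of "t - a"] P(2)[of "t - b"] P(3)[of "t - a"] P(3)[of "t - b"] \<rho>(2)
      by (auto simp: \<psi>_def \<psi>'_def B_def)
    have span: "flat_span \<psi>'"
      using flat_span.add[OF flat_span.affine[OF \<rho>(1), of 1 1 "- a"] flat_span.affine[OF \<rho>(1), of "-1" 1 "- b"]]
      by (simp add: \<psi>'_def)
    have "test_function \<psi>"
    proof -
      have "closure {t. \<psi> t \<noteq> 0} \<subseteq> {a..B}"
        by (rule closure_minimal) (use \<psi>0 in \<open>auto simp: not_le intro: less_imp_le\<close>, meson less_eq_real_def linorder_not_less)+
      moreover from this have "compact (closure {t. \<psi> t \<noteq> 0})"
        by (metis bounded_closed_interval bounded_subset closed_closure compact_eq_bounded_closed)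
      moreover have "\<psi> differentiable_on UNIV"
        by (meson \<psi>D differentiable_at_imp_differentiable_on real_differentiable_def)
      ultimately show ?thesis
        using smooth_if_deriv_flat_span[of \<psi>] span \<open>0 < a\<close> by (auto simp: test_function_def d\<psi>)
    qed
    then have "integral {0<..} (\<lambda>t. g t * \<psi>' t) = - integral {0<..} (\<lambda>t. h t * \<psi> t)"
      using gh unfolding has_distributional_derivative_def d\<psi>[symmetric] by blast
    then have weak: "integral {0..B} (\<lambda>t. g t * \<psi>' t) = - integral {0..B} (\<lambda>t. h t * \<psi> t)"
      using \<psi>0 \<open>0 < a\<close> by (subst (asm) (1 2) integral_pos_eq_integral_Icc[of B]) auto
    have "B > 0" using that by (simp add: B_def)
    have c\<psi>: "continuous_on A \<psi>" "continuous_on A \<psi>'" for A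
      by (rule DERIV_continuous_on[of _ _ \<psi>'], rule DERIV_subset[OF \<psi>D], simp)
        (rule flat_span_continuous[OF span])
    have gB: "continuous_on {0..B} g" "continuous_on {0..B} k"
      by (auto intro: continuous_on_subset[OF g] continuous_on_subset[OF k])
    \<comment> \<open>Integration by parts for H \<psi>, whose boundary terms vanish, trades h
      \<psi> for - H \<psi>'; the weak equation for g then becomes one for k alone.\<close>
    have "((\<lambda>t. H t * \<psi>' t + h t * \<psi> t) has_integral (H B * \<psi> B - H 0 * \<psi> 0)) {0..B}"
      using \<open>B > 0\<close>
      by (intro fundamental_theorem_of_calculus)
        (auto simp flip: has_real_derivative_iff_has_vector_derivative
          intro!: derivative_eq_intros HD DERIV_subset[OF \<psi>D])
    then have "integral {0..B} (\<lambda>t. H t * \<psi>' t + h t * \<psi> t) = 0"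
      using \<psi>0[of B] \<psi>0[of 0] \<open>0 < a\<close> by (simp add: integral_unique)
    then have "integral {0..B} (\<lambda>t. H t * \<psi>' t) + integral {0..B} (\<lambda>t. h t * \<psi> t) = 0"
      by (subst (asm) integral_add) (auto intro!: integrable_continuous_interval continuous_intros Hc hB c\<psi>)
    then have "integral {0..B} (\<lambda>t. g t * \<psi>' t) - integral {0..B} (\<lambda>t. H t * \<psi>' t) = 0"
      using weak by simp
    then have "integral {0..B} (\<lambda>t. g t * \<psi>' t - H t * \<psi>' t) = 0"
      by (subst integral_diff) (auto intro!: integrable_continuous_interval continuous_intros Hc gB c\<psi>)
    then have "integral {0..B} (\<lambda>t. k t * \<rho> (t - a) - k t * \<rho> (t - b)) = 0"
      by (simp add: k_def \<psi>'_def algebra_simps)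
    then have "integral {0..B} (\<lambda>t. k t * \<rho> (t - a)) - integral {0..B} (\<lambda>t. k t * \<rho> (t - b)) = 0"
      by (subst (asm) integral_diff)
        (auto intro!: integrable_continuous_interval continuous_intros gB
          continuous_on_compose2[OF flat_span_continuous[OF \<rho>(1), of UNIV]])
    then have "integral {0..\<epsilon>} (\<lambda>t. k (a + t) * \<rho> t) - integral {0..\<epsilon>} (\<lambda>t. k (b + t) * \<rho> t) = 0"
      using that by (simp add: integral_shifted_bump[OF k \<rho>] B_def)
    then have "integral {0..\<epsilon>} (\<lambda>t. k (a + t) * \<rho> t - k (b + t) * \<rho> t) = 0"
      using that by (subst integral_diff)
        (auto intro!: integrable_continuous_interval continuous_intros flat_span_continuous[OF \<rho>(1)]
          continuous_on_compose2[OF k])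
    then show ?thesis by (simp add: algebra_simps)
  qed
  txt \<open>
    If k differed at a and b, then k (a + t) - k (b + t) would keep its sign for small t, and
    its integral against a bump could not vanish.
  \<close>
  have eq: "k a = k b" if "0 < a" "a < b" for a b
  proof (rule ccontr)
    assume "k a \<noteq> k b"
    define \<sigma> where "\<sigma> = sgn (k a - k b)"
    define q where "q = (\<lambda>t. \<sigma> * (k (a + t) - k (b + t)))"
    have "q 0 > 0"
      using \<open>k a \<noteq> k b\<close> by (simp add: q_def \<sigma>_def sgn_if)
    have q: "continuous_on {0..} q"
      unfolding q_def using that by (intro continuous_intros continuous_on_compose2[OF k]) auto
    then have "(q \<longlongrightarrow> q 0) (at 0 within {0..})"
      by (auto simp: continuous_on_def)
    then have "\<forall>\<^sub>F t in at 0 within {0..}. q t > 0"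
      using \<open>q 0 > 0\<close> order_tendstoD(1) by blast
    then obtain \<delta> where "\<delta> > 0" and \<delta>: "\<And>t. 0 < t \<Longrightarrow> t < \<delta> \<Longrightarrow> q t > 0"
      by (auto simp: eventually_at dist_real_def)
    define \<epsilon> where "\<epsilon> = \<delta> / 2"
    have "0 < \<epsilon>" using \<open>\<delta> > 0\<close> by (simp add: \<epsilon>_def)
    have \<epsilon>: "q t > 0" if "t \<in> {0..\<epsilon>}" for t
      using \<delta>[of t] \<open>\<delta> > 0\<close> \<open>q 0 > 0\<close> that by (cases "t = 0") (auto simp: \<epsilon>_def)
    obtain \<rho> where \<rho>: "flat_span \<rho>" "\<And>x. 0 < x \<Longrightarrow> x < \<epsilon> \<Longrightarrow> \<rho> x > 0" "\<And>x. x \<le> 0 \<or> x \<ge> \<epsilon> \<Longrightarrow> \<rho> x = 0"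
      using bump_exists[OF \<open>0 < \<epsilon>\<close>] by blast
    have "integral {0..\<epsilon>} (\<lambda>t. q t * \<rho> t) = 0"
      using bump[OF \<rho>(1,3) \<open>0 < \<epsilon>\<close> that] by (simp add: q_def mult.assoc)
    moreover have "0 \<le> q t * \<rho> t" if "t \<in> {0..\<epsilon>}" for t
      using \<epsilon>[OF that] \<rho>(2)[of t] \<rho>(3)[of t] that by (cases "0 < t \<and> t < \<epsilon>") auto
    moreover have "continuous_on {0..\<epsilon>} (\<lambda>t. q t * \<rho> t)"
      by (intro continuous_on_mult flat_span_continuous[OF \<rho>(1)] continuous_on_subset[OF q]) auto
    ultimately have "\<forall>t\<in>{0..\<epsilon>}. q t * \<rho> t = 0"
      using integral_eq_0_iff[of 0 \<epsilon> "\<lambda>t. q t * \<rho> t"] \<open>0 < \<epsilon>\<close> by simp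
    then show False
      using \<open>0 < \<epsilon>\<close> \<epsilon>[of "\<epsilon>/2"] \<rho>(2)[of "\<epsilon>/2"] by (auto dest!: bspec[of _ _ "\<epsilon>/2"])
  qed
  have "k T = k 0"
  proof (cases "T = 0")
    case False
    then have "T > 0" using \<open>0 \<le> T\<close> by simp
    \<comment> \<open>Test functions never reach time 0, so \<open>eq\<close> covers positive times
      only; the value at 0 follows by continuity from the right.\<close>
    have "(k \<longlongrightarrow> k 0) (at_right 0)"
      using k by (auto simp: continuous_on_def intro: tendsto_within_subset[of _ _ _ "{0..}"])
    moreover have "(k \<longlongrightarrow> k T) (at_right 0)"
      by (rule tendsto_eventually) (use eq[of _ T] \<open>T > 0\<close> in \<open>auto simp: eventually_at_right_field\<close>)
    ultimately show ?thesis
      using tendsto_unique trivial_limit_at_right_real by blast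
  qed simp
  then show ?thesis
    by (simp add: k_def H_def)
qed

subsection \<open>The weighted energy balance\<close>

lemma lattice_cube_mono:
  assumes "m \<le> n"
  shows "lattice_cube m \<subseteq> lattice_cube n"
proof
  fix \<alpha> :: "int ^ 'n" assume \<alpha>: "\<alpha> \<in> lattice_cube m"
  have "- int n + 1 \<le> \<alpha> $ j \<and> \<alpha> $ j \<le> int n" for j
    using \<alpha>[unfolded lattice_cube_def, THEN CollectD, rule_format, of j] assms by linarith
  then show "\<alpha> \<in> lattice_cube n" by (simp add: lattice_cube_def)
qed

lemma lattice_cube_axis:
  assumes "\<alpha> \<in> lattice_cube n"
  shows "\<alpha> + axis j 1 \<in> lattice_cube (Suc n)" and "\<alpha> - axis j 1 \<in> lattice_cube (Suc n)"
proof -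
  have *: "- int n + 1 \<le> \<alpha> $ i" "\<alpha> $ i \<le> int n" for i
    using assms by (simp_all add: lattice_cube_def)
  then have "- int n \<le> \<alpha> $ i" "- int n < \<alpha> $ i" "\<alpha> $ i \<le> 1 + int n" "\<alpha> $ i \<le> 2 + int n" for i
    by (smt (verit))+
  with * show "\<alpha> + axis j 1 \<in> lattice_cube (Suc n)" "\<alpha> - axis j 1 \<in> lattice_cube (Suc n)"
    by (auto simp: lattice_cube_def axis_def add_increasing2 intro: order_trans)
qed

text \<open>Translating the backward difference moves the cube B to its shift A. Both contain the
  cube of size n and lie in the one of size n + 2, so the mismatch is confined to the shell between
  these, where each term is at most F times the weight.\<close>

lemma summation_by_parts_lattice_cube:
  fixes v w :: "int ^ 'n::finite \<Rightarrow> real"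
  assumes v: "\<And>\<alpha>. \<bar>v \<alpha>\<bar> \<le> F" and w: "\<And>\<alpha>. 0 \<le> w \<alpha>"
  shows "(\<Sum>\<alpha>\<in>lattice_cube (Suc n). w \<alpha> * (v \<alpha> - v (\<alpha> - axis j 1)))
    \<le> (\<Sum>\<alpha>\<in>lattice_cube (Suc n). (w \<alpha> - w (\<alpha> + axis j 1)) * v \<alpha>)
      + F * (sum w (lattice_cube (n + 2)) - sum w (lattice_cube n))"
proof -
  let ?s = "\<lambda>\<alpha>. \<alpha> + axis j (1 :: int)"
  define B where "B = (lattice_cube (Suc n) :: (int ^ 'n) set)"
  define A where "A = ?s ` B"
  define q where "q = (\<lambda>\<alpha>. w \<alpha> * v (\<alpha> - axis j 1))"
  have fin: "finite A" "finite B"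
    by (simp_all add: A_def B_def finite_lattice_cube)
  have "(\<Sum>\<alpha>\<in>B. w (?s \<alpha>) * v \<alpha>) = sum q A"
    unfolding A_def by (subst sum.reindex) (auto simp: q_def inj_on_def)
  then have "(\<Sum>\<alpha>\<in>B. w \<alpha> * (v \<alpha> - v (\<alpha> - axis j 1))) - (\<Sum>\<alpha>\<in>B. (w \<alpha> - w (?s \<alpha>)) * v \<alpha>) = sum q A - sum q B"
    by (simp add: q_def algebra_simps sum_subtractf)
  also have "\<dots> = sum q (A - B) + sum (\<lambda>\<alpha>. - q \<alpha>) (B - A)"
    using sum.Int_Diff[OF fin(1), of q B] sum.Int_Diff[OF fin(2), of q A]
    by (simp add: Int_commute sum_negf)
  also have "\<dots> \<le> (\<Sum>\<alpha>\<in>A - B. F * w \<alpha>) + (\<Sum>\<alpha>\<in>B - A. F * w \<alpha>)"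
  proof -
    have "\<bar>q \<alpha>\<bar> \<le> F * w \<alpha>" for \<alpha>
      using mult_right_mono[OF v w, of "\<alpha> - axis j 1" \<alpha>] w[of \<alpha>] by (simp add: q_def abs_mult mult.commute)
    then show ?thesis
      by (intro add_mono sum_mono) (use abs_le_D1 abs_le_D2 in blast)+
  qed
  also have "\<dots> = (\<Sum>\<alpha>\<in>(A - B) \<union> (B - A). F * w \<alpha>)"
    using fin by (intro sum.union_disjoint[symmetric]) auto
  also have "\<dots> \<le> (\<Sum>\<alpha>\<in>lattice_cube (n + 2) - lattice_cube n. F * w \<alpha>)"
  proof (rule sum_mono2)
    have "A \<subseteq> lattice_cube (n + 2)" "lattice_cube n \<subseteq> B"
      using lattice_cube_axis(1)[of _ "Suc n" j] lattice_cube_mono[of n "Suc n"] by (auto simp: A_def B_def)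
    moreover have "lattice_cube n \<subseteq> A"
    proof
      fix \<alpha> :: "int ^ 'n" assume "\<alpha> \<in> lattice_cube n"
      then have "\<alpha> - axis j 1 \<in> B"
        unfolding B_def by (rule lattice_cube_axis)
      then show "\<alpha> \<in> A"
        unfolding A_def by (rule image_eqI[rotated]) simp
    qed
    moreover have "B \<subseteq> lattice_cube (n + 2)"
      unfolding B_def by (rule lattice_cube_mono) simp
    ultimately show "(A - B) \<union> (B - A) \<subseteq> lattice_cube (n + 2) - lattice_cube n"
      by blast
    have "0 \<le> F" using v[of 0] by linarith
    then show "0 \<le> F * w \<alpha>" for \<alpha> using w by simp
  qed (simp add: finite_lattice_cube)
  also have "\<dots> = F * (sum w (lattice_cube (n + 2)) - sum w (lattice_cube n))"
    by (subst sum_diff) (simp_all add: finite_lattice_cube lattice_cube_mono sum_distrib_left algebra_simps)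
  finally show ?thesis
    by (simp add: B_def)
qed

text \<open>The square of W x + N \<beta> p is nonnegative. The share 1 / (2 N) is chosen so that
  the N directions together consume exactly half of W D. For \<beta> = 0 the first hypothesis forces
  x = 0.\<close>

lemma Young_weighted:
  fixes D p x \<beta> W N :: real
  assumes "x\<^sup>2 \<le> \<beta> * D" "W > 0" "N > 0" "0 \<le> \<beta>" "0 \<le> D"
  shows "- p * x \<le> W * D / (2 * N) + N / 2 * \<beta> * (p\<^sup>2 / W)"
proof (cases "\<beta> = 0")
  case True
  then show ?thesis using assms by simp
next
  case False
  then have "\<beta> > 0" using assms by simp
  have "x\<^sup>2 / \<beta> \<le> D" using assms(1) \<open>\<beta> > 0\<close> by (simp add: pos_divide_le_eq mult.commute)
  then have "W * (x\<^sup>2 / \<beta>) / (2 * N) \<le> W * D / (2 * N)"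
    using assms by (intro divide_right_mono mult_left_mono) auto
  moreover have "0 \<le> (W * x + N * \<beta> * p)\<^sup>2 / (2 * N * \<beta> * W)"
    using assms by simp
  moreover have "\<dots> = W * (x\<^sup>2 / \<beta>) / (2 * N) + N / 2 * \<beta> * (p\<^sup>2 / W) + p * x"
    using assms \<open>\<beta> > 0\<close> by (simp add: field_simps power2_eq_square)
  ultimately show ?thesis by linarith
qed

section \<open>The energy balance along a semiorbit\<close>

context lattice_eds
begin

lemma orbit_in_topspace: "u \<in> topspace X \<Longrightarrow> 0 \<le> t \<Longrightarrow> \<phi> u t \<in> topspace X"
  using continuous_map_funspace[OF flow_continuous] by (force simp: Pi_iff)

lemma continuous_on_orbit:
  assumes "u \<in> topspace X" "continuous_map X euclideanreal g"
  shows "continuous_on {0..} (\<lambda>t. g (\<phi> u t))"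
proof -
  have "continuous_map (top_of_set {0..}) (prod_topology X (top_of_set {0..})) (\<lambda>t. (u, t :: real))"
    using assms by (intro continuous_map_pairedI) auto
  from continuous_map_compose[OF continuous_map_compose[OF this flow_continuous] assms(2)]
  show ?thesis
    by (simp add: o_def)
qed

lemma continuous_on_dissipation:
  "u \<in> topspace X \<Longrightarrow> continuous_on {0..T} (\<lambda>t. d (\<phi> u t) \<alpha>)"
  by (rule continuous_on_subset[OF continuous_on_orbit[OF _ dissipation_continuous]]) auto

lemma continuous_on_balance:
  "u \<in> topspace X \<Longrightarrow> continuous_on {0..} (\<lambda>t. - d (\<phi> u t) \<alpha> + lattice_div (f (\<phi> u t)) \<alpha>)"
  unfolding lattice_div_def
  by (intro continuous_on_sum continuous_on_diff continuous_on_add continuous_on_minus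
      continuous_on_orbit[OF _ flux_continuous] continuous_on_orbit[OF _ dissipation_continuous])

lemma energy_increment:
  assumes "u \<in> topspace X" "0 \<le> T"
  shows "e (\<phi> u T) \<alpha> - e u \<alpha>
    = integral {0..T} (\<lambda>t. - d (\<phi> u t) \<alpha> + lattice_div (f (\<phi> u t)) \<alpha>)"
  using distributional_derivative_FTC[OF continuous_on_orbit[OF assms(1) energy_continuous]
      continuous_on_balance[OF assms(1)] energy_balance[OF assms(1)] assms(2)]
  by (simp add: flow_zero[OF assms(1)])

text \<open>Half of the weighted dissipation is spent on absorbing the flux and the other half
  survives with a negative sign. The bound F on the flux enters only through the boundary
  shells.\<close>

lemma weighted_dissipation_rate:
  fixes w :: "int ^ 'n \<Rightarrow> real"
  defines "N \<equiv> real CARD('n)"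
  assumes v: "v \<in> topspace X" and \<beta>: "\<And>\<alpha>. (norm (f v \<alpha>))\<^sup>2 \<le> \<beta> * d v \<alpha>" "0 \<le> \<beta>"
    and F: "norm (f v) \<le> F"
    and w: "\<And>\<alpha>. 0 < w \<alpha>"
    and G: "(\<Sum>\<alpha>\<in>lattice_cube (Suc n). \<Sum>j\<in>UNIV. (w (\<alpha> + axis j 1) - w \<alpha>)\<^sup>2 / w \<alpha>) \<le> G"
  shows "(\<Sum>\<alpha>\<in>lattice_cube (Suc n). w \<alpha> * (- d v \<alpha> + lattice_div (f v) \<alpha>))
    \<le> - (1 / 2) * (\<Sum>\<alpha>\<in>lattice_cube (Suc n). w \<alpha> * d v \<alpha>) + (N * \<beta> * G / 2
      + N * F * (sum w (lattice_cube (n + 2)) - sum w (lattice_cube n)))"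
proof -
  define B where "B = (lattice_cube (Suc n) :: (int ^ 'n) set)"
  have comp: "\<bar>f v \<alpha> $ j\<bar> \<le> norm (f v \<alpha>)" for \<alpha> j
    by (rule component_le_norm_cart)
  have F': "\<bar>f v \<alpha> $ j\<bar> \<le> F" for \<alpha> j
    using comp[where \<alpha> = \<alpha> and j = j] norm_bounded[of "f v" \<alpha>] F by linarith
  have N: "N > 0" by (simp add: N_def)
  have "(\<Sum>\<alpha>\<in>B. w \<alpha> * lattice_div (f v) \<alpha>)
      = (\<Sum>j\<in>UNIV. \<Sum>\<alpha>\<in>B. w \<alpha> * (f v \<alpha> $ j - f v (\<alpha> - axis j 1) $ j))"
    unfolding lattice_div_def sum_distrib_left by (rule sum.swap)
  also have "\<dots> \<le> (\<Sum>j\<in>UNIV. (\<Sum>\<alpha>\<in>B. (w \<alpha> - w (\<alpha> + axis j 1)) * f v \<alpha> $ j)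
      + F * (sum w (lattice_cube (n + 2)) - sum w (lattice_cube n)))"
    unfolding B_def
    by (intro sum_mono summation_by_parts_lattice_cube F' less_imp_le[OF w])
  also have "\<dots> = (\<Sum>\<alpha>\<in>B. \<Sum>j\<in>UNIV. (w \<alpha> - w (\<alpha> + axis j 1)) * f v \<alpha> $ j)
      + N * F * (sum w (lattice_cube (n + 2)) - sum w (lattice_cube n))"
    by (simp add: sum.distrib N_def sum.swap[of _ B])
  also have "(\<Sum>\<alpha>\<in>B. \<Sum>j\<in>UNIV. (w \<alpha> - w (\<alpha> + axis j 1)) * f v \<alpha> $ j)
      \<le> (\<Sum>\<alpha>\<in>B. \<Sum>j\<in>UNIV. w \<alpha> * d v \<alpha> / (2 * N) + N / 2 * \<beta> * ((w (\<alpha> + axis j 1) - w \<alpha>)\<^sup>2 / w \<alpha>))"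
  proof (intro sum_mono)
    fix \<alpha> j
    have "(f v \<alpha> $ j)\<^sup>2 \<le> \<beta> * d v \<alpha>"
      using \<beta>(1)[of \<alpha>] power_mono[OF comp abs_ge_zero, where n = 2, of \<alpha> j] by simp
    from Young_weighted[OF this w N \<beta>(2) dissipation_nonneg[OF v], of "w (\<alpha> + axis j 1) - w \<alpha>" \<alpha>]
    show "(w \<alpha> - w (\<alpha> + axis j 1)) * f v \<alpha> $ j
      \<le> w \<alpha> * d v \<alpha> / (2 * N) + N / 2 * \<beta> * ((w (\<alpha> + axis j 1) - w \<alpha>)\<^sup>2 / w \<alpha>)"
      by simp
  qed
  also have "\<dots> = (1 / 2) * (\<Sum>\<alpha>\<in>B. w \<alpha> * d v \<alpha>)
      + N / 2 * \<beta> * (\<Sum>\<alpha>\<in>B. \<Sum>j\<in>UNIV. (w (\<alpha> + axis j 1) - w \<alpha>)\<^sup>2 / w \<alpha>)"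
    using N by (simp add: sum.distrib sum_distrib_left sum_divide_distrib flip: N_def)
  also have "N / 2 * \<beta> * (\<Sum>\<alpha>\<in>B. \<Sum>j\<in>UNIV. (w (\<alpha> + axis j 1) - w \<alpha>)\<^sup>2 / w \<alpha>) \<le> N / 2 * \<beta> * G"
    using N \<beta>(2) G by (intro mult_left_mono) (auto simp: B_def)
  finally have "(\<Sum>\<alpha>\<in>B. w \<alpha> * lattice_div (f v) \<alpha>) \<le> (1 / 2) * (\<Sum>\<alpha>\<in>B. w \<alpha> * d v \<alpha>) + N / 2 * \<beta> * G
      + N * F * (sum w (lattice_cube (n + 2)) - sum w (lattice_cube n))" by simp
  then show ?thesis
    by (simp add: B_def[symmetric] algebra_simps sum.distrib sum_subtractf sum_negf)
qed

text \<open>S and G bound the sums over all cubes at once, so they survive the passage to the whole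
  lattice. Time integration of the rate costs a factor 2, because only half of the dissipation is
  left.\<close>

lemma weighted_dissipation_bound:
  fixes w :: "int ^ 'n \<Rightarrow> real"
  assumes u: "u \<in> topspace X" and T: "0 \<le> T"
    and \<beta>: "\<And>v \<alpha>. v \<in> topspace X \<Longrightarrow> (norm (f v \<alpha>))\<^sup>2 \<le> \<beta> * d v \<alpha>" "0 \<le> \<beta>"
    and w: "\<And>\<alpha>. 0 < w \<alpha>"
    and S: "\<And>n. sum w (lattice_cube n) \<le> S"
    and G: "\<And>n. (\<Sum>\<alpha>\<in>lattice_cube n. \<Sum>j\<in>UNIV. (w (\<alpha> + axis j 1) - w \<alpha>)\<^sup>2 / w \<alpha>) \<le> G"
    and c: "\<And>\<alpha>. \<alpha> \<in> lattice_cube R \<Longrightarrow> c \<le> w \<alpha>"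
  shows "c * total_dissipation \<phi> d u R T \<le> 2 * norm (e u) * S + real CARD('n) * \<beta> * T * G"
proof -
  let ?N = "real CARD('n)"
  define \<delta> where "\<delta> = (\<lambda>n. sum w (lattice_cube (n + 2)) - sum w (lattice_cube n))"
  \<comment> \<open>The flux norm is continuous in time, hence bounded on a compact interval. The
    bound may depend on the orbit and on T, since it multiplies only the shell sums
    \<open>\<delta> n\<close>, which tend to 0.\<close>
  have "compact ((\<lambda>t. norm (f (\<phi> u t))) ` {0..T})"
    by (intro compact_continuous_image continuous_on_subset[OF norm_flux_continuous[OF u]]) auto
  then obtain F where F: "\<And>t. t \<in> {0..T} \<Longrightarrow> norm (f (\<phi> u t)) \<le> F"
    by (meson bdd_above.E bounded_imp_bdd_above compact_imp_bounded image_eqI)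
  have bal: "continuous_on {0..T} (\<lambda>t. - d (\<phi> u t) \<alpha> + lattice_div (f (\<phi> u t)) \<alpha>)" for \<alpha>
    by (rule continuous_on_subset[OF continuous_on_balance[OF u]]) auto
  have int: "g integrable_on {0..T}" if "continuous_on {0..T} g" for g :: "real \<Rightarrow> real"
    using that by (rule integrable_continuous_interval)
  txt \<open>The error made by cutting w off outside a cube only involves the outermost shells.\<close>
  have step: "c * total_dissipation \<phi> d u R T
      \<le> 2 * norm (e u) * S + ?N * \<beta> * T * G + 2 * T * ?N * F * \<delta> n" if "n \<ge> R" for n
  proof -
    define B where "B = (lattice_cube (Suc n) :: (int ^ 'n) set)"
    define K where "K = ?N * \<beta> * G / 2 + ?N * F * \<delta> n"
    have fin: "finite B" by (simp add: B_def finite_lattice_cube)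
    have sub: "lattice_cube R \<subseteq> B" unfolding B_def using that by (intro lattice_cube_mono) simp
    \<comment> \<open>The weighted energy can fall by at most its initial value, because the final
      energy is nonnegative.\<close>
    have "- norm (e u) * S \<le> - (\<Sum>\<alpha>\<in>B. w \<alpha> * e u \<alpha>)"
    proof -
      have "(\<Sum>\<alpha>\<in>B. w \<alpha> * e u \<alpha>) \<le> (\<Sum>\<alpha>\<in>B. w \<alpha> * norm (e u))"
        using norm_bounded[of "e u"] by (intro sum_mono mult_left_mono) (auto simp: w less_imp_le abs_le_iff)
      also have "\<dots> = norm (e u) * sum w B" by (simp add: sum_distrib_right mult.commute)
      also have "\<dots> \<le> norm (e u) * S" using S by (intro mult_left_mono) (auto simp: B_def)
      finally show ?thesis by simp
    qed
    also have "\<dots> \<le> (\<Sum>\<alpha>\<in>B. w \<alpha> * e (\<phi> u T) \<alpha>) - (\<Sum>\<alpha>\<in>B. w \<alpha> * e u \<alpha>)"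
      using sum_nonneg[of B "\<lambda>\<alpha>. w \<alpha> * e (\<phi> u T) \<alpha>"] energy_nonneg[OF orbit_in_topspace[OF u T]] w
      by (simp add: less_imp_le)
    also have "\<dots> = (\<Sum>\<alpha>\<in>B. w \<alpha> * (e (\<phi> u T) \<alpha> - e u \<alpha>))"
      by (simp add: algebra_simps sum_subtractf)
    also have "\<dots> = (\<Sum>\<alpha>\<in>B. integral {0..T} (\<lambda>t. w \<alpha> * (- d (\<phi> u t) \<alpha> + lattice_div (f (\<phi> u t)) \<alpha>)))"
      using u T by (simp add: energy_increment)
    also have "\<dots> = integral {0..T} (\<lambda>t. \<Sum>\<alpha>\<in>B. w \<alpha> * (- d (\<phi> u t) \<alpha> + lattice_div (f (\<phi> u t)) \<alpha>))"
      using u fin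
      by (intro integral_sum[symmetric] int continuous_on_mult continuous_on_const bal) auto
    also have "\<dots> \<le> integral {0..T} (\<lambda>t. - (1 / 2) * (\<Sum>\<alpha>\<in>B. w \<alpha> * d (\<phi> u t) \<alpha>) + K)"
    proof (rule integral_le)
      show "(\<Sum>\<alpha>\<in>B. w \<alpha> * (- d (\<phi> u t) \<alpha> + lattice_div (f (\<phi> u t)) \<alpha>))
          \<le> - (1 / 2) * (\<Sum>\<alpha>\<in>B. w \<alpha> * d (\<phi> u t) \<alpha>) + K" if "t \<in> {0..T}" for t
        unfolding B_def K_def \<delta>_def
        using that u by (intro weighted_dissipation_rate orbit_in_topspace \<beta> F w G) auto
    next
      show "(\<lambda>t. \<Sum>\<alpha>\<in>B. w \<alpha> * (- d (\<phi> u t) \<alpha> + lattice_div (f (\<phi> u t)) \<alpha>)) integrable_on {0..T}"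
        by (intro int continuous_on_sum continuous_on_mult continuous_on_const bal)
    qed (use u in \<open>auto intro!: int continuous_intros continuous_on_dissipation\<close>)
    also have "\<dots> = - (1 / 2) * integral {0..T} (\<lambda>t. \<Sum>\<alpha>\<in>B. w \<alpha> * d (\<phi> u t) \<alpha>) + T * K"
      using u T by (subst integral_add) (auto intro!: int continuous_intros continuous_on_dissipation)
    also have "- (1 / 2) * integral {0..T} (\<lambda>t. \<Sum>\<alpha>\<in>B. w \<alpha> * d (\<phi> u t) \<alpha>)
        \<le> - (1 / 2) * (c * total_dissipation \<phi> d u R T)"
    proof -
      have "c * total_dissipation \<phi> d u R T
          = integral {0..T} (\<lambda>t. \<Sum>\<alpha>\<in>lattice_cube R. c * d (\<phi> u t) \<alpha>)"
        by (simp add: total_dissipation_def flip: sum_distrib_left)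
      also have "\<dots> \<le> integral {0..T} (\<lambda>t. \<Sum>\<alpha>\<in>B. w \<alpha> * d (\<phi> u t) \<alpha>)"
      proof (rule integral_le)
        fix t assume t: "t \<in> {0..T}"
        then have d0: "d (\<phi> u t) \<alpha> \<ge> 0" for \<alpha>
          using u by (intro dissipation_nonneg orbit_in_topspace) auto
        then have "(\<Sum>\<alpha>\<in>lattice_cube R. c * d (\<phi> u t) \<alpha>) \<le> (\<Sum>\<alpha>\<in>lattice_cube R. w \<alpha> * d (\<phi> u t) \<alpha>)"
          by (intro sum_mono mult_right_mono c)
        also have "\<dots> \<le> (\<Sum>\<alpha>\<in>B. w \<alpha> * d (\<phi> u t) \<alpha>)"
          using d0 w sub fin by (intro sum_mono2) (auto simp: less_imp_le)
        finally show "(\<Sum>\<alpha>\<in>lattice_cube R. c * d (\<phi> u t) \<alpha>) \<le> (\<Sum>\<alpha>\<in>B. w \<alpha> * d (\<phi> u t) \<alpha>)" .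
      qed (use u in \<open>auto intro!: int continuous_intros continuous_on_dissipation\<close>)
      finally show ?thesis by simp
    qed
    finally show ?thesis
      by (simp add: K_def algebra_simps)
  qed
  \<comment> \<open>Increasing bounded partial sums converge, so the shell sums, being differences
    of terms two steps apart, tend to 0.\<close>
  have lim: "(\<lambda>n. sum w (lattice_cube n)) \<longlonglongrightarrow> (SUP n. sum w (lattice_cube n))"
    by (intro LIMSEQ_incseq_SUP bdd_aboveI[of _ S])
      (use S in \<open>auto intro!: monoI sum_mono2 lattice_cube_mono simp: finite_lattice_cube less_imp_le[OF w]\<close>)
  from tendsto_diff[OF LIMSEQ_ignore_initial_segment[OF this, of 2] this]
  have "\<delta> \<longlonglongrightarrow> 0" by (simp add: \<delta>_def)
  then have "(\<lambda>n. 2 * norm (e u) * S + ?N * \<beta> * T * G + 2 * T * ?N * F * \<delta> n)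
      \<longlonglongrightarrow> 2 * norm (e u) * S + ?N * \<beta> * T * G + 2 * T * ?N * F * 0"
    by (intro tendsto_intros)
  then show ?thesis
    using step by (intro LIMSEQ_le_const[of _ "2 * norm (e u) * S + ?N * \<beta> * T * G"]) auto
qed

end

subsection \<open>Weights on the lattice\<close>

text \<open>With the l1 norm in the exponent the weight factorises over the coordinates, and its sum
  over a cube becomes a power of a one-dimensional sum.\<close>

definition exp_weight :: "real \<Rightarrow> int ^ 'n::finite \<Rightarrow> real" where
  "exp_weight L \<alpha> = exp (- (\<Sum>j\<in>UNIV. \<bar>real_of_int (\<alpha> $ j)\<bar>) / L)"

lemma exp_weight_pos: "0 < exp_weight L \<alpha>"
  by (simp add: exp_weight_def)

lemma exp_weight_le_1: "0 \<le> L \<Longrightarrow> exp_weight L \<alpha> \<le> 1"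
  by (simp add: exp_weight_def sum_nonneg)

lemma exp_minus_le:
  assumes "1 \<le> (L :: real)"
  shows "exp (- 1 / L) < 1" and "1 / (1 - exp (- 1 / L)) \<le> 2 * L"
proof -
  have "1 + 1 / L \<le> exp (1 / L)" by (rule exp_ge_add_one_self)
  then have "exp (- 1 / L) \<le> 1 / (1 + 1 / L)"
    using assms by (simp add: exp_minus field_simps)
  also have "\<dots> = L / (L + 1)" using assms by (simp add: field_simps)
  also have "\<dots> \<le> 1 - 1 / (2 * L)" using assms by (simp add: field_simps)
  finally have *: "1 / (2 * L) \<le> 1 - exp (- 1 / L)" by simp
  moreover have "0 < 1 / (2 * L)" using assms by simp
  ultimately show "exp (- 1 / L) < 1" by linarith
  with * assms show "1 / (1 - exp (- 1 / L)) \<le> 2 * L"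
    by (simp add: field_simps)
qed

text \<open>The interval is not symmetric: passing from n to n + 1 adds the points -n and n + 1,
  with values q^n and q^(n+1), where q = exp (-1/L). Together they are at most 2 q^n, which leaves
  twice a geometric series of sum at most 2 L.\<close>

lemma sum_exp_abs_le:
  assumes "1 \<le> (L :: real)"
  shows "(\<Sum>k = - int n + 1..int n. exp (- \<bar>real_of_int k\<bar> / L)) \<le> 4 * L"
proof -
  define q where "q = exp (- 1 / L)"
  have q: "0 < q" "q < 1" "1 / (1 - q) \<le> 2 * L"
    using exp_minus_le[OF assms] by (simp_all add: q_def)
  have qi: "exp (- real i / L) = q ^ i" for i
    by (simp add: q_def flip: exp_of_nat_mult)
  have "(\<Sum>k = - int n + 1..int n. exp (- \<bar>real_of_int k\<bar> / L)) \<le> 2 * (\<Sum>i<n. q ^ i)"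
  proof (induction n)
    case (Suc n)
    have "{- int (Suc n) + 1..int (Suc n)} = insert (- int n) (insert (int (Suc n)) {- int n + 1..int n})"
      by auto
    moreover have "exp (- \<bar>real_of_int (- int n)\<bar> / L) = q ^ n"
      "exp (- \<bar>real_of_int (int (Suc n))\<bar> / L) = q ^ Suc n"
      using qi[of n] qi[of "Suc n"] by (simp_all only: of_int_minus abs_minus_cancel of_int_of_nat_eq abs_of_nat)
    ultimately have "(\<Sum>k = - int (Suc n) + 1..int (Suc n). exp (- \<bar>real_of_int k\<bar> / L))
        = q ^ n + (q ^ Suc n + (\<Sum>k = - int n + 1..int n. exp (- \<bar>real_of_int k\<bar> / L)))"
      by (simp del: of_nat_Suc power_Suc)
    moreover have "q ^ Suc n \<le> q ^ n" using q by (intro power_decreasing) auto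
    ultimately show ?case using Suc by simp
  qed simp
  also have "(\<Sum>i<n. q ^ i) \<le> 1 / (1 - q)"
    using q by (simp add: sum_gp_strict divide_right_mono)
  finally show ?thesis using q by simp
qed

lemma sum_exp_weight_le:
  assumes "1 \<le> L"
  shows "(\<Sum>\<alpha>\<in>lattice_cube n. exp_weight L (\<alpha> :: int ^ 'n::finite)) \<le> (4 * L) ^ CARD('n)"
proof -
  define I where "I = {- int n + 1..int n}"
  define g where "g = (\<lambda>k :: int. exp (- \<bar>real_of_int k\<bar> / L))"
  have g: "exp_weight L \<alpha> = (\<Prod>j\<in>UNIV. g (\<alpha> $ j))" for \<alpha> :: "int ^ 'n"
    by (simp add: exp_weight_def g_def sum_negf sum_divide_distrib flip: exp_sum)
  have "bij_betw vec_lambda (UNIV \<rightarrow>\<^sub>E I) (lattice_cube n :: (int ^ 'n) set)"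
    by (rule bij_betw_byWitness[where f' = vec_nth])
      (auto simp: lattice_cube_def I_def PiE_UNIV_domain Pi_iff vec_lambda_inverse)
  then have "(\<Sum>\<alpha>\<in>lattice_cube n. exp_weight L (\<alpha> :: int ^ 'n)) = (\<Sum>h\<in>UNIV \<rightarrow>\<^sub>E I. exp_weight L (vec_lambda h :: int ^ 'n))"
    by (rule sum.reindex_bij_betw[symmetric])
  also have "\<dots> = (\<Prod>j\<in>(UNIV :: 'n set). \<Sum>k\<in>I. g k)"
    by (subst prod_sum_PiE) (auto simp: g I_def)
  also have "\<dots> \<le> (4 * L) ^ CARD('n)"
    unfolding prod_constant I_def g_def by (intro power_mono sum_exp_abs_le assms sum_nonneg) simp
  finally show ?thesis .
qed

lemma abs_exp_minus_1_le:
  assumes "\<bar>x\<bar> \<le> y" "y \<le> (1 :: real)"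
  shows "\<bar>exp x - 1\<bar> \<le> 2 * y"
proof (cases "0 \<le> x")
  case True
  then have "exp x \<le> 1 + x + x\<^sup>2" using assms by (intro exp_bound) auto
  moreover have "x\<^sup>2 \<le> x" using True assms by (simp add: power2_eq_square mult_left_le)
  ultimately show ?thesis using True assms by simp
next
  case False
  then have "exp x < 1" by simp
  with False assms exp_ge_add_one_self[of x] show ?thesis by linarith
qed

text \<open>A unit step changes the l1 norm by at most 1, hence multiplies the weight by exp x with
  |x| \<le> 1/L \<le> 1. Because the bound is relative to the weight itself, the quotient of the
  squared difference by the weight is at most 4 / L^2 times the weight.\<close>

lemma exp_weight_axis:
  assumes "1 \<le> L"
  shows "\<bar>exp_weight L (\<alpha> + axis j 1) - exp_weight L \<alpha>\<bar> \<le> 2 / L * exp_weight L (\<alpha> :: int ^ 'n::finite)"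
proof -
  define x where "x = (\<bar>real_of_int (\<alpha> $ j)\<bar> - \<bar>real_of_int (\<alpha> $ j) + 1\<bar>) / L"
  have "(\<Sum>i\<in>UNIV. \<bar>real_of_int ((\<alpha> + axis j 1) $ i)\<bar>) - (\<Sum>i\<in>UNIV. \<bar>real_of_int (\<alpha> $ i)\<bar>)
      = (\<Sum>i\<in>UNIV. if i = j then \<bar>real_of_int (\<alpha> $ j) + 1\<bar> - \<bar>real_of_int (\<alpha> $ j)\<bar> else 0)"
    unfolding sum_subtractf[symmetric] by (rule sum.cong) (auto simp: axis_def)
  also have "\<dots> = - x * L"
    using assms by (simp add: x_def)
  finally have "exp_weight L (\<alpha> + axis j 1) = exp_weight L \<alpha> * exp x"
    using assms unfolding exp_weight_def by (simp add: field_simps flip: exp_add)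
  then have "exp_weight L (\<alpha> + axis j 1) - exp_weight L \<alpha> = exp_weight L \<alpha> * (exp x - 1)"
    by (simp add: algebra_simps)
  then have "\<bar>exp_weight L (\<alpha> + axis j 1) - exp_weight L \<alpha>\<bar> = exp_weight L \<alpha> * \<bar>exp x - 1\<bar>"
    using exp_weight_pos[of L \<alpha>] by (simp add: abs_mult)
  also have "\<dots> \<le> exp_weight L \<alpha> * (2 * (1 / L))"
    using assms exp_weight_pos[of L \<alpha>]
    by (intro mult_left_mono abs_exp_minus_1_le) (auto simp: x_def abs_divide divide_right_mono)
  finally show ?thesis by (simp add: mult.commute)
qed

lemma sum_abs_lattice_cube_le:
  assumes "(\<alpha> :: int ^ 'n::finite) \<in> lattice_cube R"
  shows "(\<Sum>j\<in>UNIV. \<bar>real_of_int (\<alpha> $ j)\<bar>) \<le> real CARD('n) * real R"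
proof -
  have "\<bar>real_of_int (\<alpha> $ j)\<bar> \<le> real R" for j
  proof -
    have "- int R + 1 \<le> \<alpha> $ j" "\<alpha> $ j \<le> int R" using assms by (simp_all add: lattice_cube_def)
    then show ?thesis by linarith
  qed
  then show ?thesis
    using sum_bounded_above[of UNIV "\<lambda>j. \<bar>real_of_int (\<alpha> $ j)\<bar>" "real R"] by simp
qed

text \<open>
  An average over dyadic scales replaces a truncated logarithm because, unlike the latter, it is
  positive everywhere and has comparable values at neighbouring points.
\<close>

definition log_profile :: "nat \<Rightarrow> int ^ 'n::finite \<Rightarrow> real" where
  "log_profile m \<alpha> = (\<Sum>k<m. exp_weight (2 ^ k) \<alpha>) / m"

lemma log_profile_pos: "m > 0 \<Longrightarrow> 0 < log_profile m \<alpha>"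
  unfolding log_profile_def by (intro divide_pos_pos sum_pos exp_weight_pos) auto

lemma log_profile_le_1: "log_profile m \<alpha> \<le> 1"
  using sum_mono[of "{..<m}" "\<lambda>k. exp_weight (2 ^ k) \<alpha>" "\<lambda>_. 1"]
  by (auto simp: log_profile_def divide_le_eq exp_weight_le_1)

lemma log_profile_axis:
  "\<bar>log_profile m (\<alpha> + axis j 1) - log_profile m \<alpha>\<bar> \<le> 2 / m * (\<Sum>k<m. exp_weight (2 ^ k) \<alpha> / 2 ^ k)"
proof -
  have "\<bar>\<Sum>k<m. exp_weight (2 ^ k) (\<alpha> + axis j 1) - exp_weight (2 ^ k) \<alpha>\<bar>
      \<le> (\<Sum>k<m. 2 / 2 ^ k * exp_weight (2 ^ k) \<alpha>)"
    by (rule order_trans[OF sum_abs sum_mono]) (intro exp_weight_axis, simp)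
  then have "\<bar>\<Sum>k<m. exp_weight (2 ^ k) (\<alpha> + axis j 1) - exp_weight (2 ^ k) \<alpha>\<bar> / m
      \<le> (\<Sum>k<m. 2 / 2 ^ k * exp_weight (2 ^ k) \<alpha>) / m"
    by (rule divide_right_mono) simp
  moreover have "\<bar>\<Sum>k<m. exp_weight (2 ^ k) (\<alpha> + axis j 1) - exp_weight (2 ^ k) \<alpha>\<bar> / m
      = \<bar>log_profile m (\<alpha> + axis j 1) - log_profile m \<alpha>\<bar>"
    by (simp add: log_profile_def sum_subtractf flip: diff_divide_distrib)
  moreover have "(\<Sum>k<m. 2 / 2 ^ k * exp_weight (2 ^ k) \<alpha>) / m = 2 / m * (\<Sum>k<m. exp_weight (2 ^ k) \<alpha> / 2 ^ k)"
    by (simp add: sum_distrib_left sum_divide_distrib mult.commute)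
  ultimately show ?thesis by linarith
qed

text \<open>Squaring the profile removes the division: with x and y the neighbouring values, (y^2 -
  x^2)^2 / x^2 = (y - x)^2 (y + x)^2 / x^2, and y \<le> 3 x bounds the last quotient by 16. The
  remaining factor 4 of the constant 64 comes from \<open>log_profile_axis\<close>.\<close>

lemma log_profile_sq_axis:
  assumes "m > 0"
  shows "((log_profile m (\<alpha> + axis j 1))\<^sup>2 - (log_profile m \<alpha>)\<^sup>2)\<^sup>2 / (log_profile m \<alpha>)\<^sup>2
    \<le> 64 / (real m)\<^sup>2 * (\<Sum>k<m. exp_weight (2 ^ k) \<alpha> / 2 ^ k)\<^sup>2"
proof -
  define x y where "x = log_profile m \<alpha>" and "y = log_profile m (\<alpha> + axis j 1)"
  define D where "D = (\<Sum>k<m. exp_weight (2 ^ k) \<alpha> / 2 ^ k)"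
  have pos: "0 < x" "0 < y" using log_profile_pos assms by (auto simp: x_def y_def)
  have D: "\<bar>y - x\<bar> \<le> 2 / m * D"
    unfolding x_def y_def D_def by (rule log_profile_axis)
  have "D \<le> (\<Sum>k<m. exp_weight (2 ^ k) \<alpha>)"
    unfolding D_def by (intro sum_mono) (simp add: divide_le_eq exp_weight_pos)
  then have "2 / m * D \<le> 2 * x"
    by (simp add: x_def log_profile_def divide_right_mono)
  with D have "y + x \<le> 4 * x" by linarith
  then have "(y + x)\<^sup>2 \<le> 16 * x\<^sup>2"
    using pos power_mono[of "y + x" "4 * x" 2] by (simp add: power_mult_distrib)
  moreover have "(y - x)\<^sup>2 \<le> (2 / m * D)\<^sup>2"
    using power_mono[OF D abs_ge_zero, of 2] by simp
  ultimately have "(y - x)\<^sup>2 * (y + x)\<^sup>2 \<le> (2 / m * D)\<^sup>2 * (16 * x\<^sup>2)"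
    by (intro mult_mono) auto
  moreover have "(y\<^sup>2 - x\<^sup>2)\<^sup>2 = (y - x)\<^sup>2 * (y + x)\<^sup>2"
    by (simp add: power2_eq_square algebra_simps)
  ultimately have "(y\<^sup>2 - x\<^sup>2)\<^sup>2 / x\<^sup>2 \<le> (2 / m * D)\<^sup>2 * 16"
    using pos by (simp add: divide_le_eq mult.assoc)
  then show ?thesis
    by (simp add: x_def y_def D_def power_mult_distrib power_divide)
qed

lemma four_power: "(4 :: real) ^ k = 2 ^ k * 2 ^ k"
  by (simp flip: power_mult_distrib)

text \<open>The summand equals 2^(-|k - l|): distinct scales interact with geometric decay, so the
  double sum is of order m and not m^2.\<close>

lemma sum_pow2_min_le:
  "(\<Sum>k<m. \<Sum>l<m. 4 ^ min k l / (2 ^ k * 2 ^ l)) \<le> (4 * real m)"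
proof -
  define g :: "nat \<Rightarrow> nat \<Rightarrow> real" where "g = (\<lambda>k l. if l \<le> k then 2 ^ l / 2 ^ k else 0)"
  have "(\<Sum>l<m. g k l) \<le> 2" if "k < m" for k
  proof -
    have "(\<Sum>l<m. g k l) = (\<Sum>l\<le>k. g k l)"
      using that by (intro sum.mono_neutral_right) (auto simp: g_def)
    also have "\<dots> = (\<Sum>l\<le>k. 2 ^ l) / 2 ^ k"
      by (simp add: g_def sum_divide_distrib)
    also have "(\<Sum>l\<le>k. 2 ^ l) = (2 ^ Suc k - 1 :: real)"
      by (induction k) auto
    also have "\<dots> / 2 ^ k \<le> 2"
      by (simp add: divide_le_eq)
    finally show ?thesis .
  qed
  then have *: "(\<Sum>k<m. \<Sum>l<m. g k l) \<le> 2 * real m"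
    using sum_mono[of "{..<m}" "\<lambda>k. \<Sum>l<m. g k l" "\<lambda>_. 2"] by simp
  \<comment> \<open>The two triangular halves overlap on the diagonal, hence an inequality.\<close>
  have "4 ^ min k l / (2 ^ k * 2 ^ l) \<le> g k l + g l k" for k l
    by (auto simp: g_def min_def four_power)
  then have "(\<Sum>k<m. \<Sum>l<m. 4 ^ min k l / (2 ^ k * 2 ^ l)) \<le> (\<Sum>k<m. \<Sum>l<m. g k l + g l k)"
    by (intro sum_mono)
  also have "\<dots> = 2 * (\<Sum>k<m. \<Sum>l<m. g k l)"
    by (simp add: sum.distrib) (rule sum.swap)
  finally show ?thesis using * by simp
qed

text \<open>In dimension 2 the 4^k or so points seen at scale 2^k cancel the squared slope 4^(-k),
  so each scale contributes O(1). With m nearly orthogonal scales and the normalisation 1 / m^2 this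
  leaves O(1/m). The constant is 2 directions times 64 from the pointwise bound times 64 = 16 * 4
  from the sum over scales.\<close>

lemma log_profile_gradient:
  assumes "m > 0" "CARD('n::finite) = 2"
  shows "(\<Sum>\<alpha>\<in>lattice_cube n. \<Sum>j\<in>UNIV. ((log_profile m (\<alpha> + axis j 1))\<^sup>2 - (log_profile m (\<alpha> :: int ^ 'n))\<^sup>2)\<^sup>2
    / (log_profile m \<alpha>)\<^sup>2) \<le> 8192 / m"
proof -
  let ?E = "\<lambda>k \<alpha> :: int ^ 'n. exp_weight (2 ^ k) \<alpha>"
  have "(\<Sum>\<alpha>\<in>lattice_cube n. ?E k \<alpha> * ?E l \<alpha>) \<le> 16 * 4 ^ min k l" for k l
  proof -
    \<comment> \<open>Both weights are at most 1, so the product is at most the narrower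
      one.\<close>
    have "(\<Sum>\<alpha>\<in>lattice_cube n. ?E k \<alpha> * ?E l \<alpha>) \<le> (\<Sum>\<alpha>\<in>lattice_cube n. ?E (min k l) \<alpha>)"
    proof (rule sum_mono)
      fix \<alpha>
      show "?E k \<alpha> * ?E l \<alpha> \<le> ?E (min k l) \<alpha>"
        using exp_weight_pos[of _ \<alpha>] exp_weight_le_1[of _ \<alpha>]
        by (cases "k \<le> l") (auto simp: min_def less_imp_le intro!: mult_right_le_one_le mult_left_le_one_le)
    qed
    also have "\<dots> \<le> (4 * 2 ^ min k l)\<^sup>2"
      using sum_exp_weight_le[of "2 ^ min k l" n, where 'n = 'n] assms(2) by simp
    also have "\<dots> = 16 * 4 ^ min k l"
      by (simp add: power2_eq_square four_power)
    finally show ?thesis .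
  qed
  then have "(\<Sum>k<m. \<Sum>l<m. (\<Sum>\<alpha>\<in>lattice_cube n. ?E k \<alpha> * ?E l \<alpha>) / (2 ^ k * 2 ^ l))
      \<le> (\<Sum>k<m. \<Sum>l<m. 16 * 4 ^ min k l / (2 ^ k * 2 ^ l))"
    by (intro sum_mono divide_right_mono) auto
  also have "\<dots> = 16 * (\<Sum>k<m. \<Sum>l<m. 4 ^ min k l / (2 ^ k * 2 ^ l))"
    by (simp add: sum_distrib_left)
  also have "\<dots> \<le> 16 * (4 * real m)"
    by (intro mult_left_mono sum_pow2_min_le) simp
  also have "(\<Sum>k<m. \<Sum>l<m. (\<Sum>\<alpha>\<in>lattice_cube n. ?E k \<alpha> * ?E l \<alpha>) / (2 ^ k * 2 ^ l))
      = (\<Sum>\<alpha>\<in>lattice_cube n. (\<Sum>k<m. ?E k \<alpha> / 2 ^ k)\<^sup>2)"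
  proof -
    have "(\<Sum>\<alpha>\<in>lattice_cube n. (\<Sum>k<m. ?E k \<alpha> / 2 ^ k)\<^sup>2)
        = (\<Sum>\<alpha>\<in>lattice_cube n. \<Sum>k<m. \<Sum>l<m. ?E k \<alpha> * ?E l \<alpha> / (2 ^ k * 2 ^ l))"
      by (simp add: power2_eq_square sum_product)
    also have "\<dots> = (\<Sum>k<m. \<Sum>\<alpha>\<in>lattice_cube n. \<Sum>l<m. ?E k \<alpha> * ?E l \<alpha> / (2 ^ k * 2 ^ l))"
      by (rule sum.swap)
    also have "\<dots> = (\<Sum>k<m. \<Sum>l<m. \<Sum>\<alpha>\<in>lattice_cube n. ?E k \<alpha> * ?E l \<alpha> / (2 ^ k * 2 ^ l))"
      by (intro sum.cong refl sum.swap)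
    finally show ?thesis by (simp add: sum_divide_distrib)
  qed
  finally have *: "(\<Sum>\<alpha>\<in>lattice_cube n. (\<Sum>k<m. ?E k \<alpha> / 2 ^ k)\<^sup>2) \<le> 64 * real m" by simp
  have "(\<Sum>\<alpha>\<in>lattice_cube n. \<Sum>j\<in>UNIV. ((log_profile m (\<alpha> + axis j 1))\<^sup>2 - (log_profile m (\<alpha> :: int ^ 'n))\<^sup>2)\<^sup>2
    / (log_profile m \<alpha>)\<^sup>2)
    \<le> (\<Sum>\<alpha>\<in>lattice_cube n. \<Sum>j\<in>(UNIV :: 'n set). 64 / (real m)\<^sup>2 * (\<Sum>k<m. ?E k \<alpha> / 2 ^ k)\<^sup>2)"
    by (intro sum_mono log_profile_sq_axis assms)
  also have "\<dots> = 128 / (real m)\<^sup>2 * (\<Sum>\<alpha>\<in>lattice_cube n. (\<Sum>k<m. ?E k \<alpha> / 2 ^ k)\<^sup>2)"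
    by (simp add: assms(2) sum_distrib_left)
  also have "\<dots> \<le> 128 / (real m)\<^sup>2 * (64 * real m)"
    by (intro mult_left_mono *) simp
  also have "\<dots> = 8192 / m"
    using assms(1) by (simp add: power2_eq_square)
  finally show ?thesis .
qed

lemma sum_log_profile_sq_le:
  assumes "m > 0" "CARD('n::finite) = 2"
  shows "(\<Sum>\<alpha>\<in>lattice_cube n. (log_profile m (\<alpha> :: int ^ 'n))\<^sup>2) \<le> 16 * 4 ^ m"
proof -
  have "(\<Sum>\<alpha>\<in>lattice_cube n. (log_profile m (\<alpha> :: int ^ 'n))\<^sup>2) \<le> (\<Sum>\<alpha>\<in>lattice_cube n. log_profile m (\<alpha> :: int ^ 'n))"
    using log_profile_pos[OF assms(1)] log_profile_le_1
    unfolding power2_eq_square by (intro sum_mono mult_left_le_one_le) (auto intro: less_imp_le)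
  also have "\<dots> = (\<Sum>k<m. \<Sum>\<alpha>\<in>lattice_cube n. exp_weight (2 ^ k) (\<alpha> :: int ^ 'n)) / m"
    by (simp add: log_profile_def sum.swap[of _ _ "lattice_cube n"] flip: sum_divide_distrib)
  also have "\<dots> \<le> (\<Sum>k<m. 16 * 4 ^ m) / m"
  proof (intro divide_right_mono sum_mono)
    fix k assume "k \<in> {..<m}"
    have "(\<Sum>\<alpha>\<in>lattice_cube n. exp_weight (2 ^ k) (\<alpha> :: int ^ 'n)) \<le> (4 * 2 ^ k)\<^sup>2"
      using sum_exp_weight_le[of "2 ^ k" n, where 'n = 'n] assms(2) by simp
    also have "\<dots> = 16 * 4 ^ k"
      by (simp add: power2_eq_square four_power)
    also have "\<dots> \<le> 16 * 4 ^ m"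
      using \<open>k \<in> {..<m}\<close> by (simp add: power_increasing)
    finally show "(\<Sum>\<alpha>\<in>lattice_cube n. exp_weight (2 ^ k) (\<alpha> :: int ^ 'n)) \<le> 16 * 4 ^ m" .
  qed simp
  finally show ?thesis using assms(1) by simp
qed

text \<open>At scales k \<ge> 2 R one has 2^k \<ge> 2 R, which bounds the l1 norm on the cube, so
  the weight is at least exp (-1) \<ge> 1/3. As 4 R \<le> m, these are at least half of the m
  scales. The threshold is crude in R, but R stays fixed while m grows with T.\<close>

lemma log_profile_ge:
  assumes "\<alpha> \<in> lattice_cube R" "4 * R \<le> m" "m > 0" "CARD('n::finite) = 2"
  shows "1 / 6 \<le> log_profile m (\<alpha> :: int ^ 'n)"
proof -
  have "real m / 6 \<le> (\<Sum>k = 2 * R..<m. 1 / 3 :: real)"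
    using assms(2) by (simp add: of_nat_diff)
  also have "\<dots> \<le> (\<Sum>k = 2 * R..<m. exp_weight (2 ^ k) \<alpha>)"
  proof (rule sum_mono)
    fix k assume "k \<in> {2 * R..<m}"
    have "(\<Sum>j\<in>UNIV. \<bar>real_of_int (\<alpha> $ j)\<bar>) \<le> real (2 * R)"
      using sum_abs_lattice_cube_le[OF assms(1)] assms(4) by simp
    also have "\<dots> \<le> 2 ^ (2 * R)"
      using of_nat_less_two_power[of "2 * R", where 'a = real] by (rule less_imp_le)
    also have "\<dots> \<le> 2 ^ k"
      using \<open>k \<in> _\<close> by (intro power_increasing) auto
    finally have "(\<Sum>j\<in>UNIV. \<bar>real_of_int (\<alpha> $ j)\<bar>) / 2 ^ k \<le> 1" by simp
    then have "exp (- 1) \<le> exp_weight (2 ^ k) \<alpha>"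
      by (simp add: exp_weight_def)
    moreover have "1 / 3 \<le> exp (- 1 :: real)"
      using exp_le by (simp add: exp_minus field_simps)
    ultimately show "1 / 3 \<le> exp_weight (2 ^ k) \<alpha>" by linarith
  qed
  also have "\<dots> \<le> (\<Sum>k<m. exp_weight (2 ^ k) \<alpha>)"
    by (intro sum_mono2) (auto simp: less_imp_le exp_weight_pos)
  finally show ?thesis
    using assms(3) by (simp add: log_profile_def field_simps)
qed

subsection \<open>Growth of the dissipation\<close>

lemma Limsup_at_top_le_of_tendsto:
  fixes g h :: "real \<Rightarrow> real"
  assumes "\<forall>\<^sub>F T in at_top. g T \<le> h T" "(h \<longlongrightarrow> c) at_top"
  shows "Limsup at_top (\<lambda>T. ereal (g T)) \<le> ereal c"
proof -
  have "Limsup at_top (\<lambda>T. ereal (g T)) \<le> Limsup at_top (\<lambda>T. ereal (h T))"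
    using assms(1) by (intro Limsup_mono) (auto elim: eventually_mono)
  also have "\<dots> = ereal c"
    using assms(2) by (intro lim_imp_Limsup) auto
  finally show ?thesis .
qed

context lattice_eds
begin

lemma dissipation_bound_exp:
  assumes u: "u \<in> topspace X" and T: "0 \<le> T"
    and \<beta>: "\<And>v \<alpha>. v \<in> topspace X \<Longrightarrow> (norm (f v \<alpha>))\<^sup>2 \<le> \<beta> * d v \<alpha>" "0 \<le> \<beta>"
    and L: "1 \<le> L"
  shows "exp (- (real CARD('n) * real R) / L) * total_dissipation \<phi> d u R T
    \<le> 2 * norm (e u) * (4 * L) ^ CARD('n)
      + real CARD('n) * \<beta> * T * (real CARD('n) * (4 / L\<^sup>2) * (4 * L) ^ CARD('n))"
proof (rule weighted_dissipation_bound[OF u T \<beta> exp_weight_pos sum_exp_weight_le[OF L]])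
  show "exp (- (real CARD('n) * real R) / L) \<le> exp_weight L \<alpha>"
    if "(\<alpha> :: int ^ 'n) \<in> lattice_cube R" for \<alpha>
    using sum_abs_lattice_cube_le[OF that] L by (simp add: exp_weight_def divide_right_mono)
  have *: "(exp_weight L (\<alpha> + axis j 1) - exp_weight L \<alpha>)\<^sup>2 / exp_weight L \<alpha> \<le> 4 / L\<^sup>2 * exp_weight L \<alpha>"
    for \<alpha> :: "int ^ 'n" and j
  proof -
    have "(exp_weight L (\<alpha> + axis j 1) - exp_weight L \<alpha>)\<^sup>2 \<le> (2 / L * exp_weight L \<alpha>)\<^sup>2"
      using power_mono[OF exp_weight_axis[OF L] abs_ge_zero, where n = 2] by simp
    then show ?thesis
      using exp_weight_pos[of L \<alpha>] by (simp add: divide_le_eq power2_eq_square)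
  qed
  show "(\<Sum>\<alpha>\<in>lattice_cube n. \<Sum>j\<in>UNIV. (exp_weight L (\<alpha> + axis j 1) - exp_weight L (\<alpha> :: int ^ 'n))\<^sup>2
      / exp_weight L \<alpha>) \<le> real CARD('n) * (4 / L\<^sup>2) * (4 * L) ^ CARD('n)" for n
  proof -
    have "(\<Sum>\<alpha>\<in>lattice_cube n. \<Sum>j\<in>UNIV. (exp_weight L (\<alpha> + axis j 1) - exp_weight L (\<alpha> :: int ^ 'n))\<^sup>2
        / exp_weight L \<alpha>) \<le> (\<Sum>\<alpha>\<in>lattice_cube n. \<Sum>j\<in>(UNIV :: 'n set). 4 / L\<^sup>2 * exp_weight L (\<alpha> :: int ^ 'n))"
      by (intro sum_mono *)
    also have "\<dots> = real CARD('n) * (4 / L\<^sup>2) * (\<Sum>\<alpha>\<in>lattice_cube n. exp_weight L (\<alpha> :: int ^ 'n))"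
      by (simp add: sum_distrib_left mult.assoc)
    also have "\<dots> \<le> real CARD('n) * (4 / L\<^sup>2) * (4 * L) ^ CARD('n)"
      by (intro mult_left_mono sum_exp_weight_le[OF L]) simp
    finally show ?thesis .
  qed
qed

lemma dissipation_bound_log:
  assumes u: "u \<in> topspace X" and T: "0 \<le> T"
    and \<beta>: "\<And>v \<alpha>. v \<in> topspace X \<Longrightarrow> (norm (f v \<alpha>))\<^sup>2 \<le> \<beta> * d v \<alpha>" "0 \<le> \<beta>"
    and m: "4 * R \<le> m" "m > 0" and N: "CARD('n) = 2"
  shows "1 / 36 * total_dissipation \<phi> d u R T \<le> 2 * norm (e u) * (16 * 4 ^ m) + 2 * \<beta> * T * (8192 / real m)"
proof -
  have "1 / 36 * total_dissipation \<phi> d u R T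
      \<le> 2 * norm (e u) * (16 * 4 ^ m) + real CARD('n) * \<beta> * T * (8192 / real m)"
  proof (rule weighted_dissipation_bound[OF u T \<beta> _ sum_log_profile_sq_le[OF m(2) N] log_profile_gradient[OF m(2) N]])
    show "0 < (log_profile m \<alpha>)\<^sup>2" for \<alpha> :: "int ^ 'n"
      using log_profile_pos[OF m(2), of \<alpha>] by simp
    show "1 / 36 \<le> (log_profile m \<alpha>)\<^sup>2" if "(\<alpha> :: int ^ 'n) \<in> lattice_cube R" for \<alpha>
      using power_mono[OF log_profile_ge[OF that m N], of 2] by (simp add: power2_eq_square)
  qed
  then show ?thesis by (simp add: N)
qed

text \<open>The optimal \<lambda> is of order sqrt (\<beta> / e0), which is unusable when \<beta> or
  e0 is 0. Both are enlarged by \<delta> > 0, and \<delta> tends to 0 after the limit in T.\<close>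

lemma Limsup_dissipation_1:
  assumes u: "u \<in> topspace X"
    and \<beta>: "\<And>v \<alpha>. v \<in> topspace X \<Longrightarrow> (norm (f v \<alpha>))\<^sup>2 \<le> \<beta> * d v \<alpha>" "0 \<le> \<beta>"
    and N: "CARD('n) = 1"
  shows "Limsup at_top (\<lambda>T. ereal (1 / sqrt T * total_dissipation \<phi> d u R T))
    \<le> ereal (24 * sqrt (\<beta> * norm (e u)))"
proof -
  let ?D = "total_dissipation \<phi> d u R"
  have *: "Limsup at_top (\<lambda>T. ereal (1 / sqrt T * ?D T)) \<le> ereal (24 * sqrt ((\<beta> + \<delta>) * (norm (e u) + \<delta>)))"
    if "\<delta> > 0" for \<delta>
  proof -
    \<comment> \<open>l plays the role of \<lambda>. It is the minimiser up to a factor sqrt 2, and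
      at this l the two terms become 8 p q and 16 p q, whence 24.\<close>
    define p q l where "p = sqrt (\<beta> + \<delta>)" and "q = sqrt (norm (e u) + \<delta>)" and "l = p / q"
    have pq: "p > 0" "q > 0" "\<beta> \<le> p\<^sup>2" "norm (e u) \<le> q\<^sup>2"
      using that \<beta>(2) by (auto simp: p_def q_def add_nonneg_pos)
    then have "l > 0" by (simp add: l_def)
    have "8 * norm (e u) * l + 16 * \<beta> / l \<le> 8 * q\<^sup>2 * l + 16 * p\<^sup>2 / l"
      using pq \<open>l > 0\<close> by (intro add_mono mult_right_mono divide_right_mono) auto
    also have "\<dots> = 24 * (p * q)"
      using pq by (simp add: l_def power2_eq_square)
    finally have K: "8 * norm (e u) * l + 16 * \<beta> / l \<le> 24 * sqrt ((\<beta> + \<delta>) * (norm (e u) + \<delta>))"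
      by (simp add: p_def q_def real_sqrt_mult)
    have "\<forall>\<^sub>F T in at_top. 1 / sqrt T * ?D T \<le> exp (real R / (l * sqrt T)) * (8 * norm (e u) * l + 16 * \<beta> / l)"
      \<comment> \<open>This threshold makes the width L = l sqrt T at least 1.\<close>
      using eventually_ge_at_top[of "1 / l\<^sup>2"]
    proof eventually_elim
      case (elim T)
      have "T > 0" using elim \<open>l > 0\<close> by (meson less_le_trans zero_less_divide_1_iff zero_less_power)
      define s where "s = sqrt T"
      have s: "s > 0" "T = s\<^sup>2" using \<open>T > 0\<close> by (auto simp: s_def)
      have "1 \<le> l * s"
        using elim \<open>l > 0\<close> s by (intro power2_le_imp_le[of 1]) (auto simp: power_mult_distrib divide_le_eq mult.commute)
      from dissipation_bound_exp[OF u _ \<beta> this, of T R] \<open>T > 0\<close>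
      have "exp (- (real R / (l * s))) * ?D T \<le> 8 * norm (e u) * (l * s) + \<beta> * T * (4 / (l * s)\<^sup>2 * (4 * (l * s)))"
        by (simp add: N)
      also have "\<dots> = s * (8 * norm (e u) * l + 16 * \<beta> / l)"
        using s \<open>l > 0\<close> by (simp add: field_simps power2_eq_square)
      finally have "?D T / s \<le> exp (real R / (l * s)) * (8 * norm (e u) * l + 16 * \<beta> / l)"
        using s by (simp add: exp_minus field_simps)
      then show ?case by (simp add: s_def)
    qed
    moreover have "((\<lambda>T. exp (real R / (l * sqrt T)) * (8 * norm (e u) * l + 16 * \<beta> / l))
        \<longlongrightarrow> exp 0 * (8 * norm (e u) * l + 16 * \<beta> / l)) at_top"
      using \<open>l > 0\<close>
      by (intro tendsto_intros tendsto_divide_0[OF tendsto_const] filterlim_at_top_imp_at_infinity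
          filterlim_tendsto_pos_mult_at_top[OF tendsto_const] sqrt_at_top)
    ultimately have "Limsup at_top (\<lambda>T. ereal (1 / sqrt T * ?D T)) \<le> ereal (exp 0 * (8 * norm (e u) * l + 16 * \<beta> / l))"
      by (rule Limsup_at_top_le_of_tendsto)
    then show ?thesis using K by (simp add: order_trans)
  qed
  have "(\<lambda>n. 24 * sqrt ((\<beta> + 1 / real (Suc n)) * (norm (e u) + 1 / real (Suc n))))
      \<longlonglongrightarrow> 24 * sqrt ((\<beta> + 0) * (norm (e u) + 0))"
    by (intro tendsto_intros LIMSEQ_Suc[OF lim_1_over_n])
  then have "(\<lambda>n. ereal (24 * sqrt ((\<beta> + 1 / real (Suc n)) * (norm (e u) + 1 / real (Suc n)))))
      \<longlonglongrightarrow> ereal (24 * sqrt (\<beta> * norm (e u)))"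
    by simp
  then show ?thesis
    by (rule LIMSEQ_le_const) (use * in auto)
qed

lemma Limsup_dissipation_2:
  assumes u: "u \<in> topspace X"
    and \<beta>: "\<And>v \<alpha>. v \<in> topspace X \<Longrightarrow> (norm (f v \<alpha>))\<^sup>2 \<le> \<beta> * d v \<alpha>" "0 \<le> \<beta>"
    and N: "CARD('n) = 2"
  shows "Limsup at_top (\<lambda>T. ereal (ln T / T * total_dissipation \<phi> d u R T)) \<le> ereal (3538944 * \<beta>)"
proof -
  let ?D = "total_dissipation \<phi> d u R"
  \<comment> \<open>The constants collect 3456 = 36 * 2 * 16 * 3 and 3538944 = 36 * 2 * 8192 * 6;
    here 36 undoes the lower bound 1/36 of the weight on the cube, and 6 comes from m \<ge> ln T /
    6.\<close>
  let ?h = "\<lambda>T :: real. 3456 * norm (e u) * ((ln T / 3) ^ 1 / exp (ln T / 3)) + 3538944 * \<beta>"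
  have "\<forall>\<^sub>F T in at_top. ln T / T * ?D T \<le> ?h T"
    \<comment> \<open>From ln T \<ge> 6 rounding down loses at most half of ln T / 3, and the
      summand 24 R then secures 4 R \<le> m.\<close>
    using eventually_ge_at_top[of "exp (6 + 24 * real R)"]
  proof eventually_elim
    case (elim T)
    have T: "T > 0" using elim by (meson exp_gt_zero less_le_trans)
    have lnT: "ln T \<ge> 6 + 24 * real R" using elim T by (simp add: ln_ge_iff)
    have "0 < ln T" using lnT by simp
    then have "1 < T" using T by simp
    \<comment> \<open>As 4 \<le> exp 2, this gives 4^m \<le> T^(2/3), so the energy term is
      negligible against T / ln T while m remains of order ln T.\<close>
    define m where "m = nat \<lfloor>ln T / 3\<rfloor>"
    have m1: "real m \<le> ln T / 3" and m2: "ln T / 6 \<le> real m"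
      using lnT by (auto simp: m_def) linarith+
    have "real (4 * R) \<le> real m" "0 < real m" using lnT m2 by simp_all
    then have m: "4 * R \<le> m" "m > 0" by linarith+
    have "(4 :: real) \<le> exp 2"
      using exp_ge_add_one_self[of 1] power_mono[of 2 "exp (1 :: real)" 2] by (simp flip: exp_double)
    then have "(4 :: real) ^ m \<le> exp 2 ^ m" by (rule power_mono) simp
    also have "\<dots> \<le> exp (ln T - ln T / 3)"
      using m1 by (simp add: mult.commute flip: exp_of_nat_mult)
    also have "\<dots> = T / exp (ln T / 3)" unfolding exp_diff using T by simp
    finally have 4: "4 ^ m \<le> T / exp (ln T / 3)" .
    have "?D T \<le> 36 * (2 * norm (e u) * (16 * 4 ^ m) + 2 * \<beta> * T * (8192 / real m))"
      using dissipation_bound_log[OF u _ \<beta> m N, of T] T by simp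
    also have "\<dots> \<le> 36 * (2 * norm (e u) * (16 * (T / exp (ln T / 3))) + 2 * \<beta> * T * (8192 / (ln T / 6)))"
      using 4 m2 lnT T \<open>1 < T\<close> \<beta>(2)
      by (intro mult_left_mono add_mono divide_left_mono) (auto intro!: mult_pos_pos)
    finally have "ln T / T * ?D T \<le> ln T / T * (36 * (2 * norm (e u) * (16 * (T / exp (ln T / 3))) + 2 * \<beta> * T * (8192 / (ln T / 6))))"
      using T \<open>0 < ln T\<close> by (intro mult_left_mono divide_nonneg_pos) auto
    also have "\<dots> = ?h T"
      using \<open>1 < T\<close> by (simp add: field_simps)
    finally show ?case .
  qed
  moreover have "(?h \<longlongrightarrow> 3456 * norm (e u) * 0 + 3538944 * \<beta>) at_top"
  proof (intro tendsto_add tendsto_mult tendsto_const)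
    have "filterlim (\<lambda>T :: real. 1 / 3 * ln T) at_top at_top"
      by (rule filterlim_tendsto_pos_mult_at_top[OF tendsto_const _ ln_at_top]) simp
    then show "((\<lambda>T :: real. (ln T / 3) ^ 1 / exp (ln T / 3)) \<longlongrightarrow> 0) at_top"
      by (intro filterlim_compose[OF tendsto_power_div_exp_0]) simp
  qed
  ultimately have "Limsup at_top (\<lambda>T. ereal (ln T / T * ?D T)) \<le> ereal (3456 * norm (e u) * 0 + 3538944 * \<beta>)"
    by (rule Limsup_at_top_le_of_tendsto)
  then show ?thesis by simp
qed

text \<open>With L = R the energy term does not depend on T and disappears after division by T. The
  factor exp N compensates the weight exp (- N R / L) = exp (- N) on the cube.\<close>

lemma Limsup_dissipation_3:
  assumes u: "u \<in> topspace X"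
    and \<beta>: "\<And>v \<alpha>. v \<in> topspace X \<Longrightarrow> (norm (f v \<alpha>))\<^sup>2 \<le> \<beta> * d v \<alpha>" "0 \<le> \<beta>"
    and N: "CARD('n) \<ge> 3" and R: "R \<ge> 1"
  shows "Limsup at_top (\<lambda>T. ereal (1 / T * total_dissipation \<phi> d u R T))
    \<le> ereal (exp (real CARD('n)) * 4 * (real CARD('n))\<^sup>2 * 4 ^ CARD('n) * \<beta> * real R ^ (CARD('n) - 2))"
proof -
  let ?D = "total_dissipation \<phi> d u R" and ?N = "real CARD('n)"
  define A where "A = exp ?N * (2 * norm (e u) * (4 * real R) ^ CARD('n))"
  define K where "K = exp ?N * 4 * ?N\<^sup>2 * 4 ^ CARD('n) * \<beta> * real R ^ (CARD('n) - 2)"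
  have "CARD('n) = 2 + (CARD('n) - 2)"
    using N by simp
  then have "real R ^ CARD('n) = (real R)\<^sup>2 * real R ^ (CARD('n) - 2)"
    by (metis power_add)
  then have RN: "4 / (real R)\<^sup>2 * (4 * real R) ^ CARD('n) = 4 * 4 ^ CARD('n) * real R ^ (CARD('n) - 2)"
    using R by (simp add: power_mult_distrib)
  have "\<forall>\<^sub>F T in at_top. 1 / T * ?D T \<le> A / T + K"
    using eventually_gt_at_top[of 0]
  proof eventually_elim
    case (elim T)
    from dissipation_bound_exp[OF u _ \<beta>, of T "real R" R] R elim
    have "exp (- ?N) * ?D T \<le> 2 * norm (e u) * (4 * real R) ^ CARD('n)
        + ?N * \<beta> * T * (?N * (4 / (real R)\<^sup>2 * (4 * real R) ^ CARD('n)))"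
      by (simp add: mult.assoc)
    then have "?D T \<le> exp ?N * (2 * norm (e u) * (4 * real R) ^ CARD('n)
        + ?N * \<beta> * T * (?N * (4 / (real R)\<^sup>2 * (4 * real R) ^ CARD('n))))"
      by (simp add: exp_minus field_simps)
    also have "\<dots> = A + T * K"
      unfolding RN A_def K_def by (simp add: algebra_simps power2_eq_square)
    finally show ?case
      using elim by (simp add: field_simps)
  qed
  moreover have "((\<lambda>T. A / T + K) \<longlongrightarrow> 0 + K) at_top"
    by (intro tendsto_intros tendsto_divide_0[OF tendsto_const] filterlim_at_top_imp_at_infinity filterlim_ident)
  ultimately have "Limsup at_top (\<lambda>T. ereal (1 / T * ?D T)) \<le> ereal (0 + K)"
    by (rule Limsup_at_top_le_of_tendsto)
  then show ?thesis by (simp add: K_def)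
qed

end

section \<open>One constant for all bounded systems\<close>

lemma bounded_lattice_eds_flux:
  assumes "bounded_lattice_eds X \<phi> e d f b" "v \<in> topspace X"
  defines "\<beta> \<equiv> (SUP w\<in>topspace X. b (norm (e w)))"
  shows "bdd_above ((\<lambda>w. b (norm (e w))) ` topspace X)"
    and "0 \<le> \<beta>" and "(norm (f v \<alpha>))\<^sup>2 \<le> \<beta> * d v \<alpha>"
proof -
  interpret lattice_eds X \<phi> e d f b
    using assms(1) by (simp add: bounded_lattice_eds_def)
  obtain M where M: "\<And>w. w \<in> topspace X \<Longrightarrow> norm (e w) \<le> M"
    using assms(1) by (auto simp: bounded_lattice_eds_def bdd_above_def)
  \<comment> \<open>A real supremum is an upper bound only if the set is bounded above; the bound on
    the energies passes to b by monotonicity.\<close>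
  show bdd: "bdd_above ((\<lambda>w. b (norm (e w))) ` topspace X)"
    by (rule bdd_aboveI2[of _ _ "b M"])
      (use M norm_ge_zero order_trans in \<open>blast intro!: mono_onD[OF b_mono]\<close>)
  have le: "b (norm (e v)) \<le> \<beta>"
    unfolding \<beta>_def by (rule cSUP_upper[OF assms(2) bdd])
  then show "0 \<le> \<beta>" using b_nonneg[of "norm (e v)"] by simp
  show "(norm (f v \<alpha>))\<^sup>2 \<le> \<beta> * d v \<alpha>"
    using flux_bound[OF assms(2), of \<alpha>] mult_right_mono[OF le dissipation_nonneg[OF assms(2), of \<alpha>]]
    by linarith
qed

lemma valid_eds_constant_exists: "\<exists>C > 0. valid_eds_constant TYPE('x) TYPE('n::finite) C"
proof (intro exI conjI)
  \<comment> \<open>K is the constant for dimension at least 3. Adding the one for dimension 2,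
    which exceeds the 24 of dimension 1, dominates all three cases.\<close>
  define K where "K = exp (real CARD('n)) * 4 * (real CARD('n))\<^sup>2 * 4 ^ CARD('n)"
  have "0 \<le> K" by (simp add: K_def)
  then show "0 < 3538944 + K" by simp
  show "valid_eds_constant TYPE('x) TYPE('n) (3538944 + K)"
    unfolding valid_eds_constant_def Let_def
  proof (intro allI impI, elim conjE, intro conjI impI)
    fix X :: "'x topology" and \<phi> and e d :: "'x \<Rightarrow> ('n, real) linf" and f :: "'x \<Rightarrow> ('n, real ^ 'n) linf"
      and b u and R :: nat
    assume eds: "bounded_lattice_eds X \<phi> e d f b" and u: "u \<in> topspace X" and R: "1 \<le> R"
    define \<beta> where "\<beta> = (SUP w\<in>topspace X. b (norm (e w)))"
    interpret lattice_eds X \<phi> e d f b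
      using eds by (simp add: bounded_lattice_eds_def)
    note \<beta> = bounded_lattice_eds_flux(3,2)[OF eds, folded \<beta>_def]
    have \<beta>0: "0 \<le> \<beta>" using \<beta>(2)[OF u] .
    {
      assume N: "CARD('n) = 1"
      have "24 * sqrt (\<beta> * norm (e u)) \<le> (3538944 + K) * sqrt (\<beta> * norm (e u))"
        using \<open>0 \<le> K\<close> \<beta>0 by (intro mult_right_mono) auto
      then show "Limsup at_top (\<lambda>T. ereal (1 / sqrt T * total_dissipation \<phi> d u R T))
          \<le> ereal ((3538944 + K) * sqrt (\<beta> * norm (e (\<phi> u 0))))"
        using Limsup_dissipation_1[OF u \<beta>(1) \<beta>0 N, of R] by (simp add: flow_zero[OF u] order_trans)
    next
      assume N: "CARD('n) = 2"
      have "3538944 * \<beta> \<le> (3538944 + K) * \<beta>"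
        using \<open>0 \<le> K\<close> \<beta>0 by (intro mult_right_mono) auto
      then show "Limsup at_top (\<lambda>T. ereal (ln T / T * total_dissipation \<phi> d u R T)) \<le> ereal ((3538944 + K) * \<beta>)"
        using Limsup_dissipation_2[OF u \<beta>(1) \<beta>0 N, of R] by (simp add: order_trans)
    next
      assume N: "CARD('n) \<ge> 3"
      have "K * \<beta> * real R ^ (CARD('n) - 2) \<le> (3538944 + K) * \<beta> * real R ^ (CARD('n) - 2)"
        using \<open>0 \<le> K\<close> \<beta>0 by (intro mult_right_mono) auto
      then show "Limsup at_top (\<lambda>T. ereal (1 / T * total_dissipation \<phi> d u R T))
          \<le> ereal ((3538944 + K) * \<beta> * real R ^ (CARD('n) - 2))"
        using Limsup_dissipation_3[OF u \<beta>(1) \<beta>0 N R, folded K_def] by (simp add: order_trans)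
    }
  qed
qed

subsection \<open>Independence of the state space\<close>

text \<open>
  A semiorbit is itself a system whose points are times. Time runs on I along the retraction r,
  which stops where the dissipation vanishes identically; without stopping there, the point would
  violate the axiom that such points are stationary.
\<close>

lemma orbit_bounded_lattice_eds:
  fixes e :: "'x \<Rightarrow> ('n::finite, real) linf" and I :: "real set"
  assumes eds: "bounded_lattice_eds X \<phi> e d f b" and u: "u \<in> topspace X"
    and I: "I \<subseteq> {0..}" and r: "continuous_on {0..} r" "\<And>t. 0 \<le> t \<Longrightarrow> r t \<in> I" "\<And>t. t \<in> I \<Longrightarrow> r t = t"
    and r_add: "\<And>s t. \<lbrakk>0 \<le> s; 0 \<le> t\<rbrakk> \<Longrightarrow> r (r s + t) = r (s + t)"
    and \<phi>_r: "\<And>t. 0 \<le> t \<Longrightarrow> \<phi> u (r t) = \<phi> u t"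
    and stop: "\<And>s t. \<lbrakk>s \<in> I; \<And>\<alpha>. d (\<phi> u s) \<alpha> = 0; 0 \<le> t\<rbrakk> \<Longrightarrow> r (s + t) = s"
  shows "bounded_lattice_eds (top_of_set I) (\<lambda>s t. r (s + t))
    (\<lambda>s. e (\<phi> u s)) (\<lambda>s. d (\<phi> u s)) (\<lambda>s. f (\<phi> u s)) b"
proof -
  interpret lattice_eds X \<phi> e d f b
    using eds by (simp add: bounded_lattice_eds_def)
  have I0: "s \<in> I \<Longrightarrow> 0 \<le> s" for s using I by auto
  have top: "s \<in> I \<Longrightarrow> \<phi> u s \<in> topspace X" for s
    using orbit_in_topspace[OF u] I0 by blast
  have shift: "\<phi> u (r (s + t)) = \<phi> (\<phi> u s) t" if "s \<in> I" "0 \<le> t" for s t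
    using that I0[of s] \<phi>_r[of "s + t"] flow_add[OF u, of s t] by simp
  have ex: "\<exists>b. \<forall>w\<in>topspace X. norm (e w) \<le> b"
    using eds by (auto simp: bounded_lattice_eds_def bdd_above_def)
  have cont: "continuous_map (top_of_set I) euclideanreal (\<lambda>s. g (\<phi> u s))"
    if "continuous_map X euclideanreal g" for g
    using continuous_on_subset[OF continuous_on_orbit[OF u that] I] by simp
  interpret orbit: semiflow "top_of_set I" "\<lambda>s t. r (s + t)"
  proof
    show "metrizable_space (top_of_set I)"
      by (simp add: metrizable_space_euclidean metrizable_space_subtopology)
    show "continuous_map (prod_topology (top_of_set I) (top_of_set {0..})) (top_of_set I) (\<lambda>(s, t). r (s + t))"
      using I0 r(2)
      by (auto simp: prod_topology_subtopology_eu case_prod_unfold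
          intro!: continuous_on_compose2[OF r(1)] continuous_intros)
    fix s assume "s \<in> topspace (top_of_set I)"
    then have s: "s \<in> I" by simp
    show "r (s + 0) = s" using r(3)[OF s] by simp
    show "r (s + (t + t')) = r (r (s + t) + t')" if "0 \<le> t" "0 \<le> t'" for t t'
      using r_add[of "s + t" t'] that I0[OF s] by (simp add: add.assoc)
  qed
  have "lattice_eds (top_of_set I) (\<lambda>s t. r (s + t))
    (\<lambda>s. e (\<phi> u s)) (\<lambda>s. d (\<phi> u s)) (\<lambda>s. f (\<phi> u s)) b"
  proof
    fix s assume "s \<in> topspace (top_of_set I)"
    then have s: "s \<in> I" by simp
    have orbit_cong: "continuous_on {0..} (\<lambda>t. g (\<phi> u (r (s + t)))) \<longleftrightarrow> continuous_on {0..} (\<lambda>t. g (\<phi> (\<phi> u s) t))"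
      for g :: "'x \<Rightarrow> real"
      by (intro continuous_on_cong) (simp_all add: shift[OF s])
    show "0 \<le> e (\<phi> u s) \<alpha>" "0 \<le> d (\<phi> u s) \<alpha>" for \<alpha>
      using top[OF s] energy_nonneg dissipation_nonneg by auto
    show "continuous_on {0..} (\<lambda>t. norm (e (\<phi> u (r (s + t)))))"
      using norm_energy_continuous[OF top[OF s]] orbit_cong[of "\<lambda>v. norm (e v)"] by blast
    show "continuous_on {0..} (\<lambda>t. norm (d (\<phi> u (r (s + t)))))"
      using norm_dissipation_continuous[OF top[OF s]] orbit_cong[of "\<lambda>v. norm (d v)"] by blast
    show "continuous_on {0..} (\<lambda>t. norm (f (\<phi> u (r (s + t)))))"
      using norm_flux_continuous[OF top[OF s]] orbit_cong[of "\<lambda>v. norm (f v)"] by blast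
    show "(norm (f (\<phi> u s) \<alpha>))\<^sup>2 \<le> b (norm (e (\<phi> u s))) * d (\<phi> u s) \<alpha>" for \<alpha>
      by (rule flux_bound[OF top[OF s]])
    show "has_distributional_derivative (\<lambda>t. e (\<phi> u (r (s + t))) \<alpha>)
        (\<lambda>t. - d (\<phi> u (r (s + t))) \<alpha> + lattice_div (f (\<phi> u (r (s + t)))) \<alpha>)" for \<alpha>
    proof -
      have "integral {0<..} (\<lambda>t. e (\<phi> u (r (s + t))) \<alpha> * deriv \<psi> t)
          = integral {0<..} (\<lambda>t. e (\<phi> (\<phi> u s) t) \<alpha> * deriv \<psi> t)"
        "integral {0<..} (\<lambda>t. (- d (\<phi> u (r (s + t))) \<alpha> + lattice_div (f (\<phi> u (r (s + t)))) \<alpha>) * \<psi> t)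
          = integral {0<..} (\<lambda>t. (- d (\<phi> (\<phi> u s) t) \<alpha> + lattice_div (f (\<phi> (\<phi> u s) t)) \<alpha>) * \<psi> t)" for \<psi>
        by (intro integral_cong; simp add: shift[OF s])+
      then show ?thesis
        using energy_balance[OF top[OF s], of \<alpha>] unfolding has_distributional_derivative_def
        by (simp only:)
    qed
    show "orbit.stationary s" if "\<And>\<alpha>. d (\<phi> u s) \<alpha> = 0"
      unfolding orbit.stationary_def using stop[OF s that] by blast
  next
    show "continuous_map (top_of_set I) euclideanreal (\<lambda>s. e (\<phi> u s) \<alpha>)" for \<alpha>
      by (rule cont[OF energy_continuous])
    show "continuous_map (top_of_set I) euclideanreal (\<lambda>s. d (\<phi> u s) \<alpha>)" for \<alpha>
      by (rule cont[OF dissipation_continuous])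
    show "continuous_map (top_of_set I) euclideanreal (\<lambda>s. f (\<phi> u s) \<alpha> $ j)" for \<alpha> j
      by (rule cont[OF flux_continuous])
    show "0 \<le> b x" if "0 \<le> x" for x using b_nonneg that .
    show "mono_on {0..} b" by (rule b_mono)
  qed
  then show ?thesis
    using ex top by (auto simp: bounded_lattice_eds_def bdd_above_def)
qed

lemma orbit_clock:
  assumes eds: "bounded_lattice_eds X \<phi> (e :: 'x \<Rightarrow> ('n::finite, real) linf) d f b" and u: "u \<in> topspace X"
  obtains I r where "0 \<in> I" "r 0 = (0 :: real)" "\<And>t. 0 \<le> t \<Longrightarrow> \<phi> u (r t) = \<phi> u t" "\<And>s. s \<in> I \<Longrightarrow> 0 \<le> s"
    "bounded_lattice_eds (top_of_set I) (\<lambda>s t. r (s + t))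
      (\<lambda>s. e (\<phi> u s)) (\<lambda>s. d (\<phi> u s)) (\<lambda>s. f (\<phi> u s)) b"
proof -
  interpret lattice_eds X \<phi> e d f b
    using eds by (simp add: bounded_lattice_eds_def)
  define Z where "Z = {s \<in> {0..}. \<forall>\<alpha>. d (\<phi> u s) \<alpha> = 0}"
  show ?thesis
  proof (cases "Z = {}")
    case True
    show ?thesis
    proof (rule that[of "{0..}" "\<lambda>t. t"])
      show "bounded_lattice_eds (top_of_set {0..}) (\<lambda>s t. s + t)
          (\<lambda>s. e (\<phi> u s)) (\<lambda>s. d (\<phi> u s)) (\<lambda>s. f (\<phi> u s)) b"
      proof (rule orbit_bounded_lattice_eds[OF eds u])
        show "continuous_on {0..} (\<lambda>t :: real. t)" by (rule continuous_on_id)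
        show "s + t = s" if "s \<in> {0..}" "\<And>\<alpha>. d (\<phi> u s) \<alpha> = 0" for s t
          using True that by (auto simp: Z_def)
      qed auto
    qed auto
  next
    case False
    \<comment> \<open>The set of times without dissipation is closed, so its infimum is attained.
      From that time on the orbit is stationary, hence stopping the clock there does not change
      it.\<close>
    have "Z = (\<Inter>\<alpha>. {s \<in> {0..}. d (\<phi> u s) \<alpha> = 0})"
      by (auto simp: Z_def)
    moreover have "closed {s \<in> {0..}. d (\<phi> u s) \<alpha> = 0}" for \<alpha>
      by (intro continuous_closed_preimage_constant continuous_on_orbit u dissipation_continuous) auto
    ultimately have "closed Z" by auto
    moreover have bdd: "bdd_below Z" by (auto simp: Z_def)
    ultimately have Inf: "Inf Z \<in> Z"
      using False closed_contains_Inf by blast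
    define s0 where "s0 = Inf Z"
    have s0: "0 \<le> s0" "\<And>\<alpha>. d (\<phi> u s0) \<alpha> = 0" using Inf by (auto simp: Z_def s0_def)
    have least: "s0 \<le> s" if "0 \<le> s" "\<And>\<alpha>. d (\<phi> u s) \<alpha> = 0" for s
      using cInf_lower[OF _ bdd, of s] that by (simp add: Z_def s0_def)
    have "stationary (\<phi> u s0)"
      using no_dissipation_stationary orbit_in_topspace[OF u s0(1)] s0(2) by blast
    then have st: "\<phi> u t = \<phi> u s0" if "s0 \<le> t" for t
      using flow_add[OF u s0(1), of "t - s0"] that by (simp add: stationary_def)
    show ?thesis
    proof (rule that[of "{0..s0}" "\<lambda>t. min t s0"])
      show "bounded_lattice_eds (top_of_set {0..s0}) (\<lambda>s t. min (s + t) s0)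
          (\<lambda>s. e (\<phi> u s)) (\<lambda>s. d (\<phi> u s)) (\<lambda>s. f (\<phi> u s)) b"
      proof (rule orbit_bounded_lattice_eds[OF eds u])
        show "min (s + t) s0 = s" if "s \<in> {0..s0}" "\<And>\<alpha>. d (\<phi> u s) \<alpha> = 0" "0 \<le> t" for s t
          using least[of s] that by auto
        show "continuous_on {0..} (\<lambda>t. min t s0)"
          by (intro continuous_intros)
        show "\<phi> u (min t s0) = \<phi> u t" if "0 \<le> t" for t
          using st[of t] by (simp add: min_def)
      qed (use s0(1) in auto)
      show "\<phi> u (min t s0) = \<phi> u t" if "0 \<le> t" for t
        using st[of t] by (simp add: min_def)
    qed (use s0(1) in auto)
  qed
qed

theorem corollary3:
  shows "eds_constant TYPE('n::finite) > 0 \<and>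
     (\<forall>(X :: 'x topology) \<phi> (e :: 'x \<Rightarrow> ('n, real) linf) d f b u (R::nat).
        bounded_lattice_eds X \<phi> e d f b \<and> u \<in> topspace X \<and> R \<ge> 1 \<longrightarrow>
        (let \<beta> = (SUP w\<in>topspace X. b (norm (e w)));
             e0 = norm (e (\<phi> u 0));
             D = total_dissipation \<phi> d u;
             C = eds_constant TYPE('n)
         in (CARD('n) = 1 \<longrightarrow>
               Limsup at_top (\<lambda>T. ereal (1 / sqrt T * D R T)) \<le> ereal (C * sqrt (\<beta> * e0))) \<and>
            (CARD('n) = 2 \<longrightarrow>
               Limsup at_top (\<lambda>T. ereal (ln T / T * D R T)) \<le> ereal (C * \<beta>)) \<and>
            (CARD('n) \<ge> 3 \<longrightarrow>
               Limsup at_top (\<lambda>T. ereal (1 / T * D R T))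
                 \<le> ereal (C * \<beta> * real R ^ (CARD('n) - 2)))))"
proof -
  define C where "C = eds_constant TYPE('n)"
  have C: "C > 0" "valid_eds_constant TYPE(real) TYPE('n) C"
    unfolding C_def eds_constant_def
    using someI_ex[OF valid_eds_constant_exists[where 'x = real and 'n = 'n]] by auto
  show ?thesis
    unfolding Let_def C_def[symmetric]
  proof (intro conjI allI impI; (elim conjE)?)
    show "0 < C" by (fact C(1))
  next
    fix X :: "'x topology" and \<phi> and e d :: "'x \<Rightarrow> ('n, real) linf" and f :: "'x \<Rightarrow> ('n, real ^ 'n) linf"
      and b u and R :: nat
    assume eds: "bounded_lattice_eds X \<phi> e d f b" and u: "u \<in> topspace X" and R: "1 \<le> R"
    obtain I r where I: "0 \<in> I" "r 0 = (0 :: real)" "\<And>t. 0 \<le> t \<Longrightarrow> \<phi> u (r t) = \<phi> u t" "\<And>s. s \<in> I \<Longrightarrow> 0 \<le> s"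
      and eds': "bounded_lattice_eds (top_of_set I) (\<lambda>s t. r (s + t))
        (\<lambda>s. e (\<phi> u s)) (\<lambda>s. d (\<phi> u s)) (\<lambda>s. f (\<phi> u s)) b"
      using orbit_clock[OF eds u] by blast
    interpret lattice_eds X \<phi> e d f b
      using eds by (simp add: bounded_lattice_eds_def)
    define \<beta> \<beta>' where "\<beta> = (SUP w\<in>topspace X. b (norm (e w)))"
      and "\<beta>' = (SUP s\<in>I. b (norm (e (\<phi> u s))))"
    \<comment> \<open>The semiorbit visits only part of the state space, so its own supremum is the
      smaller one, and all three bounds increase with \<beta>.\<close>
    have "\<beta>' \<le> \<beta>"
      unfolding \<beta>_def \<beta>'_def
      using I(1,4) u orbit_in_topspace
      by (intro cSUP_mono[OF _ bounded_lattice_eds_flux(1)[OF eds u]]) auto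
    \<comment> \<open>The clock started at 0 reproduces the original orbit, so both systems have the
      same dissipation at every T.\<close>
    have D: "total_dissipation (\<lambda>s t. r (s + t)) (\<lambda>s. d (\<phi> u s)) 0 R = total_dissipation \<phi> d u R"
      unfolding total_dissipation_def using I(3) by (intro ext integral_cong) simp
    note valid = C(2)[unfolded valid_eds_constant_def, THEN spec, of "top_of_set I", THEN spec, of "\<lambda>s t. r (s + t)",
        THEN spec, of "\<lambda>s. e (\<phi> u s)", THEN spec, of "\<lambda>s. d (\<phi> u s)", THEN spec, of "\<lambda>s. f (\<phi> u s)",
        THEN spec, of b, THEN spec, of 0, THEN spec, of R, THEN mp, unfolded Let_def D topspace_euclidean_subtopology
        add_0_right I(2), folded \<beta>'_def]
    have valid': "bounded_lattice_eds (top_of_set I) (\<lambda>s t. r (s + t))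
        (\<lambda>s. e (\<phi> u s)) (\<lambda>s. d (\<phi> u s)) (\<lambda>s. f (\<phi> u s)) b \<and> 0 \<in> I \<and> 1 \<le> R"
      using eds' I(1) R by blast
    note valid = valid[OF valid']
    show "Limsup at_top (\<lambda>T. ereal (1 / sqrt T * total_dissipation \<phi> d u R T))
        \<le> ereal (C * sqrt ((SUP w\<in>topspace X. b (norm (e w))) * norm (e (\<phi> u 0))))" if "CARD('n) = 1"
    proof -
      have "C * sqrt (\<beta>' * norm (e (\<phi> u 0))) \<le> C * sqrt (\<beta> * norm (e (\<phi> u 0)))"
        using C(1) \<open>\<beta>' \<le> \<beta>\<close> by (intro mult_left_mono real_sqrt_le_mono mult_right_mono) auto
      with valid[THEN conjunct1, rule_format, OF that] show ?thesis
        unfolding \<beta>_def[symmetric] by (meson ereal_less_eq(3) order_trans)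
    qed
    show "Limsup at_top (\<lambda>T. ereal (ln T / T * total_dissipation \<phi> d u R T))
        \<le> ereal (C * (SUP w\<in>topspace X. b (norm (e w))))" if "CARD('n) = 2"
    proof -
      have "C * \<beta>' \<le> C * \<beta>"
        using C(1) \<open>\<beta>' \<le> \<beta>\<close> by simp
      with valid[THEN conjunct2, THEN conjunct1, rule_format, OF that] show ?thesis
        unfolding \<beta>_def[symmetric] by (meson ereal_less_eq(3) order_trans)
    qed
    show "Limsup at_top (\<lambda>T. ereal (1 / T * total_dissipation \<phi> d u R T))
        \<le> ereal (C * (SUP w\<in>topspace X. b (norm (e w))) * real R ^ (CARD('n) - 2))" if "CARD('n) \<ge> 3"
    proof -
      have "C * \<beta>' * real R ^ (CARD('n) - 2) \<le> C * \<beta> * real R ^ (CARD('n) - 2)"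
        using C(1) \<open>\<beta>' \<le> \<beta>\<close> by (intro mult_right_mono mult_left_mono) auto
      with valid[THEN conjunct2, THEN conjunct2, rule_format, OF that] show ?thesis
        unfolding \<beta>_def[symmetric] by (meson ereal_less_eq(3) order_trans)
    qed
  qed
qed

end
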